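(* Let $\rho\in(0,1)$ and $c\in L^\infty(B_\rho(e_1))$. Suppose that $u\in C^{2s+\alpha}(B_\rho(e_1))\cap\mathscr A_s(\mathbb{R}^n)$ for some $\alpha>0$ with $2s+\alpha$ not an integer, $u\geq0$ in $\mathbb{R}^n_+$, and $(-\Delta)^su+cu=0$ in $B_\rho(e_1)$. Then there exists $C_\rho>0$ depending only on $n$, $s$, $\|c\|_{L^\infty(B_\rho(e_1))}$ and $\rho$ such that $$\sup_{B_{\rho/2}(e_1)}u\leq C_\rho\inf_{B_{\rho/2}(e_1)}u.$$ Moreover, both $\sup_{B_{\rho/2}(e_1)}u$ and $\inf_{B_{\rho/2}(e_1)}u$ are comparable to $\|u\|_{\mathscr A_s(\mathbb{R}^n)}$, i.e. bounded above and below by positive constants (with the same dependence) times $\|u\|_{\mathscr A_s(\mathbb{R}^n)}$.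
   Context: Fix $n\geq1$, $s\in(0,1)$; $e_1=(1,0,\dots,0)$. For $x\in\mathbb{R}^n$ write $x=(x_1,x')$, $x_\ast=(-x_1,x')$; $u$ is antisymmetric if $u(x_\ast)=-u(x)$ for all $x$. $\mathbb{R}^n_+=\{x_1>0\}$. $\mathscr A_s(\mathbb{R}^n)$ is the set of antisymmetric $u\in L^1_{loc}(\mathbb{R}^n)$ with $\|u\|_{\mathscr A_s(\mathbb{R}^n)}:=\int_{\mathbb{R}^n_+}\frac{x_1|u(x)|}{1+|x|^{n+2s+2}}dx<\infty$. For non-integer $\beta>0$, $C^\beta=C^{\lfloor\beta\rfloor,\beta-\lfloor\beta\rfloor}$. With $c_{n,s}=\frac{s4^s\Gamma(\frac{n+2s}{2})}{\pi^{n/2}\Gamma(1-s)}$, for $u\in\mathscr A_s(\mathbb{R}^n)$ that is $C^{2s+\alpha}$ near $x\in\mathbb{R}^n_+$, $(-\Delta)^su(x):=c_{n,s}\lim_{\varepsilon\to0^+}\int_{\mathbb{R}^n_+\setminus B_\varepsilon(x)}\big(|x-y|^{-n-2s}-|x_\ast-y|^{-n-2s}\big)(u(x)-u(y))dy+\frac{c_{1,s}}{s}u(x)x_1^{-2s}$; equations are understood pointwise with this definition. *)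

theory Defs
  imports "HOL-Analysis.Analysis"
begin

text \<open>Conventions. The ambient space R^n is an arbitrary Euclidean space 'a, n = DIM('a).
  The distinguished unit vector e_1 is a fixed basis vector e; the first coordinate
  of x is x \<bullet> e.\<close>

definition refl_e :: "'a::euclidean_space \<Rightarrow> 'a \<Rightarrow> 'a" where
  "refl_e e x = x - (2 * (x \<bullet> e)) *\<^sub>R e"

definition halfspace :: "'a::euclidean_space \<Rightarrow> 'a set" where
  "halfspace e = {x. x \<bullet> e > 0}"

definition antisymmetric_fun :: "'a::euclidean_space \<Rightarrow> ('a \<Rightarrow> real) \<Rightarrow> bool" where
  "antisymmetric_fun e u \<longleftrightarrow> (\<forall>x. u (refl_e e x) = - u x)"

definition locally_integrable :: "('a::euclidean_space \<Rightarrow> real) \<Rightarrow> bool" where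
  "locally_integrable u \<longleftrightarrow> (\<forall>K. compact K \<longrightarrow> u absolutely_integrable_on K)"

definition As_weight :: "real \<Rightarrow> 'a::euclidean_space \<Rightarrow> ('a \<Rightarrow> real) \<Rightarrow> 'a \<Rightarrow> real" where
  "As_weight s e u x = (x \<bullet> e) * \<bar>u x\<bar> / (1 + norm x powr (real DIM('a) + 2 * s + 2))"

definition As_space :: "real \<Rightarrow> 'a::euclidean_space \<Rightarrow> ('a \<Rightarrow> real) \<Rightarrow> bool" where
  "As_space s e u \<longleftrightarrow> antisymmetric_fun e u \<and> locally_integrable u \<and>
     (As_weight s e u) integrable_on (halfspace e)"

definition As_norm :: "real \<Rightarrow> 'a::euclidean_space \<Rightarrow> ('a \<Rightarrow> real) \<Rightarrow> real" where
  "As_norm s e u = integral (halfspace e) (As_weight s e u)"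

text \<open>Hoelder space C^{k,gamma}(Omega) with finite norm: iterated partial derivatives
  D ds (ds a list of basis directions, D (b # ds) = partial_b (D ds)) up to order k exist
  (Frechet differentiability of all orders < k), all of them are bounded and continuous on
  Omega, and those of order k are gamma-Hoelder continuous on Omega.\<close>

definition hoelder_kg :: "nat \<Rightarrow> real \<Rightarrow> 'a::euclidean_space set \<Rightarrow> ('a \<Rightarrow> real) \<Rightarrow> bool" where
  "hoelder_kg k \<gamma> \<Omega> f \<longleftrightarrow>
     (\<exists>D :: 'a list \<Rightarrow> 'a \<Rightarrow> real.
        (\<forall>x\<in>\<Omega>. D [] x = f x) \<and>
        (\<forall>ds. set ds \<subseteq> Basis \<and> length ds < k \<longrightarrow>
           (\<forall>x\<in>\<Omega>. (D ds has_derivative (\<lambda>h. \<Sum>b\<in>Basis. (h \<bullet> b) * D (b # ds) x)) (at x))) \<and>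
        (\<forall>ds. set ds \<subseteq> Basis \<and> length ds \<le> k \<longrightarrow>
           continuous_on \<Omega> (D ds) \<and> bounded (D ds ` \<Omega>)) \<and>
        (\<forall>ds. set ds \<subseteq> Basis \<and> length ds = k \<longrightarrow>
           (\<exists>H. \<forall>x\<in>\<Omega>. \<forall>y\<in>\<Omega>. \<bar>D ds x - D ds y\<bar> \<le> H * dist x y powr \<gamma>)))"

definition hoelder :: "real \<Rightarrow> 'a::euclidean_space set \<Rightarrow> ('a \<Rightarrow> real) \<Rightarrow> bool" where
  "hoelder \<beta> \<Omega> f \<longleftrightarrow> hoelder_kg (nat \<lfloor>\<beta>\<rfloor>) (\<beta> - of_int \<lfloor>\<beta>\<rfloor>) \<Omega> f"

definition c_ns :: "nat \<Rightarrow> real \<Rightarrow> real" where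
  "c_ns n s = s * 4 powr s * Gamma ((real n + 2 * s) / 2) / (pi powr (real n / 2) * Gamma (1 - s))"

definition frac_kernel_integrand ::
  "real \<Rightarrow> 'a::euclidean_space \<Rightarrow> ('a \<Rightarrow> real) \<Rightarrow> 'a \<Rightarrow> 'a \<Rightarrow> real" where
  "frac_kernel_integrand s e u x y =
     (norm (x - y) powr (- (real DIM('a) + 2 * s)) - norm (refl_e e x - y) powr (- (real DIM('a) + 2 * s)))
     * (u x - u y)"

definition frac_laplacian_at ::
  "real \<Rightarrow> 'a::euclidean_space \<Rightarrow> ('a \<Rightarrow> real) \<Rightarrow> 'a \<Rightarrow> real \<Rightarrow> bool" where
  "frac_laplacian_at s e u x v \<longleftrightarrow>
     (\<forall>\<epsilon>>0. frac_kernel_integrand s e u x absolutely_integrable_on (halfspace e - ball x \<epsilon>)) \<and>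
     (\<exists>L. ((\<lambda>\<epsilon>. integral (halfspace e - ball x \<epsilon>) (frac_kernel_integrand s e u x)) \<longlongrightarrow> L) (at_right 0) \<and>
          v = c_ns DIM('a) s * L + c_ns 1 s / s * u x * (x \<bullet> e) powr (- 2 * s))"

end

theory Submission
  imports Defs
begin

text \<open>Both bounds come from touching \<open>u\<close> by a paraboloid at a point \<open>x\<close> near \<open>e\<close>. In the principal
  value at \<open>x\<close> the linear part of the paraboloid integrates to a bounded error by symmetry, its quadratic
  part contributes \<open>O(\<delta> powr (2 - 2 * s))\<close>, and what remains is an integral with a sign, against a kernel
  that is comparable to the weight of \<open>As_norm\<close>. Touching from below thus gives \<open>As_norm \<le> C * u x\<close>.
  Touching from above at scale \<open>\<delta>\<close> gives the term \<open>c * u x * \<delta> powr (- 2 * s)\<close>, which for small \<open>\<delta>\<close>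
  beats the zero order terms, so that \<open>u x\<close> is at most a multiple of \<open>As_norm\<close>.\<close>

text \<open>The constant may depend neither on the Hoelder norm of \<open>u\<close> nor on
  \<open>\<alpha>\<close>, so the regularity of \<open>u\<close> enters only qualitatively: it makes
  touching points exist and the principal value continuous in \<open>x\<close>. The quantitative
  input is the sign of \<open>u\<close> in the half-space and a bound of the principal value by a
  multiple of \<open>u x\<close>. The weight appears because the squared distances from
  \<open>y\<close> to \<open>x\<close> and to its reflection differ by exactly 4 x_1 y_1, so the
  difference of the two powers carries the factor y_1 and an exponent lowered by 2. Touching happens
  at an extremum of \<open>u\<close> plus or minus a paraboloid, not at a prescribed point. From
  below this is harmless, since the value at the touching point is at most the prescribed one. From
  above it is the main obstacle: \<open>u\<close> may grow towards the boundary of the ball, so no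
  value at a prescribed point controls the opening of the paraboloid, and \<open>\<delta>\<close>
  has to shrink with the distance to that boundary.\<close>

section \<open>Integrals of powers of the distance, odd integrands, differences of negative
  powers\<close>

text \<open>The series of \<open>c k * indicator (S k)\<close> dominates \<open>f\<close> on
  \<open>A\<close>, because every point of \<open>A\<close> is accounted for by one of its terms; it
  is then integrated termwise. Overlaps among the \<open>S k\<close> only enlarge the series, so
  full balls can be used in place of disjoint shells.\<close>

lemma integral_le_sum_cover:
  fixes f :: "'a::euclidean_space \<Rightarrow> real" and S :: "nat \<Rightarrow> 'a set"
  assumes S: "\<And>k. S k \<in> sets borel" "\<And>k. emeasure lborel (S k) \<le> ennreal (m k)"
    and nonneg: "\<And>k. 0 \<le> c k" "\<And>k. 0 \<le> m k" and sm: "summable (\<lambda>k. c k * m k)"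
    and bound: "\<And>y. y \<in> A \<Longrightarrow> 0 \<le> f y \<and> (\<exists>k. y \<in> S k \<and> f y \<le> c k)"
    and A: "A \<in> sets borel" and f: "f \<in> borel_measurable borel"
  shows "f integrable_on A" "integral A f \<le> (\<Sum>k. c k * m k)"
proof -
  have "(\<integral>\<^sup>+y. ennreal (f y) * indicator A y \<partial>lborel)
      \<le> (\<integral>\<^sup>+y. (\<Sum>k. ennreal (c k) * indicator (S k) y) \<partial>lborel)"
  proof (rule nn_integral_mono)
    fix y :: 'a
    show "ennreal (f y) * indicator A y \<le> (\<Sum>k. ennreal (c k) * indicator (S k) y)"
    proof (cases "y \<in> A")
      case True
      then obtain k where k: "y \<in> S k" "f y \<le> c k" using bound by blast
      have "ennreal (f y) * indicator A y \<le> (\<Sum>i\<in>{k}. ennreal (c i) * indicator (S i) y)"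
        using k True by (simp add: ennreal_leI)
      also have "\<dots> \<le> (\<Sum>k. ennreal (c k) * indicator (S k) y)"
        by (rule sum_le_suminf) auto
      finally show ?thesis .
    qed auto
  qed
  also have "\<dots> = (\<Sum>k. \<integral>\<^sup>+y. ennreal (c k) * indicator (S k) y \<partial>lborel)"
    by (rule nn_integral_suminf) (use S(1) in measurable)
  also have "\<dots> = (\<Sum>k. ennreal (c k) * emeasure lborel (S k))"
    using S(1) by (intro suminf_cong nn_integral_cmult_indicator) auto
  also have "\<dots> \<le> (\<Sum>k. ennreal (c k) * ennreal (m k))"
    by (intro suminf_le mult_left_mono S) auto
  also have "\<dots> = (\<Sum>k. ennreal (c k * m k))"
    by (simp add: ennreal_mult nonneg)
  also have "\<dots> = ennreal (\<Sum>k. c k * m k)"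
    by (rule suminf_ennreal2) (use nonneg sm in auto)
  finally have le: "(\<integral>\<^sup>+y. ennreal (f y) * indicator A y \<partial>lborel) \<le> ennreal (\<Sum>k. c k * m k)" .
  have le': "(\<integral>\<^sup>+y. ennreal (indicator A y * f y) \<partial>lborel) \<le> ennreal (\<Sum>k. c k * m k)"
    proof -
    have "(\<integral>\<^sup>+y. ennreal (indicator A y * f y) \<partial>lborel) = (\<integral>\<^sup>+y. ennreal (f y) * indicator A y \<partial>lborel)"
      by (intro nn_integral_cong) (auto simp: indicator_def)
    thus ?thesis using le by simp
  qed
  have "(\<lambda>y. indicator A y * f y) integrable_on UNIV"
    by (rule nn_integral_integrable_on)
      (use A f bound le' in \<open>auto simp: indicator_def intro: le_less_trans\<close>)
  moreover have *: "(\<lambda>y. indicator A y * f y) = (\<lambda>y. if y \<in> A then f y else 0)"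
    by (auto simp: indicator_def)
  ultimately show int: "f integrable_on A"
    by (simp add: integrable_restrict_UNIV)
  have "ennreal (integral A f) = (\<integral>\<^sup>+y. ennreal (f y) * indicator A y \<partial>lborel)"
    by (rule nn_integral_has_integral_lebesgue'[symmetric])
      (use bound int in \<open>auto simp: has_integral_integral[symmetric]\<close>)
  with le have "ennreal (integral A f) \<le> ennreal (\<Sum>k. c k * m k)" by simp
  thus "integral A f \<le> (\<Sum>k. c k * m k)"
    by (subst (asm) ennreal_le_iff) (auto intro!: suminf_nonneg sm simp: nonneg)
qed

lemma ex_half_power:
  fixes t d :: real
  assumes "0 < t" "t \<le> d"
  shows "\<exists>k. d * (1/2) ^ Suc k < t \<and> t \<le> d * (1/2) ^ k"
proof -
  have d: "d > 0" using assms by linarith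
  obtain j where "(1/2) ^ j < t / d"
    using real_arch_pow_inv[of "t/d" "1/2"] assms d by auto
  hence j: "d * (1/2) ^ j < t" using d by (simp add: field_simps)
  \<comment> \<open>The least such exponent is positive because \<open>t \<le> d\<close>; its
    predecessor is the witness.\<close>
  define k where "k = (LEAST j. d * (1/2) ^ j < t)"
  have k: "d * (1/2) ^ k < t" unfolding k_def by (rule LeastI[of _ j]) (rule j)
  have "k \<noteq> 0"
    using k assms by (cases k) auto
  then obtain i where i: "k = Suc i" by (cases k) auto
  have "\<not> d * (1/2) ^ i < t"
    using not_less_Least[of i "\<lambda>j. d * (1/2) ^ j < t"] i unfolding k_def by auto
  thus ?thesis using k i by (intro exI[of _ i]) auto
qed

text \<open>Dyadic shells: the mass of \<open>\<bar>x - y\<bar> powr (a - n)\<close> on the shell of radius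
  \<open>d / 2 ^ k\<close> is comparable to \<open>(d / 2 ^ k) powr a\<close>.\<close>

lemma integral_cball_powr_le:
  fixes a :: real
  assumes a: "0 < a" and d: "0 < d" and A: "A \<in> sets borel" "A \<subseteq> cball x d - {x}"
  defines "n \<equiv> real DIM('a::euclidean_space)"
  shows "(\<lambda>y::'a. norm (x - y) powr (a - n)) integrable_on A"
    "integral A (\<lambda>y::'a. norm (x - y) powr (a - n))
       \<le> 2 powr n * unit_ball_vol n * (\<Sum>k. ((1/2) powr a) ^ k) * d powr a"
proof -
  let ?S = "\<lambda>k. cball x (d * (1/2) ^ k)"
  define m where "m = (\<lambda>k::nat. unit_ball_vol n * (d * (1/2) ^ k) ^ DIM('a))"
  \<comment> \<open>On the shell numbered \<open>k\<close> the distance lies between half of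
    \<open>d * (1/2) ^ k\<close> and that radius. The factor \<open>2 powr n\<close> comes from
    evaluating the power \<open>- n\<close> at the inner radius.\<close>
  define c where "c = (\<lambda>k::nat. 2 powr n * (d * (1/2) ^ k) powr (a - n))"
  have cm: "c k * m k = 2 powr n * unit_ball_vol n * d powr a * ((1/2) powr a) ^ k" for k
  proof -
    have "(d * (1/2) ^ k) powr (a - n) * (d * (1/2) ^ k) ^ DIM('a) = (d * (1/2) ^ k) powr a"
      using d by (simp add: n_def powr_realpow[symmetric] powr_add[symmetric])
    also have "\<dots> = d powr a * ((1/2) powr a) ^ k"
      using d by (simp add: powr_mult powr_realpow[symmetric] powr_powr powr_powr mult.commute)
    finally show ?thesis by (simp add: c_def m_def)
  qed
  have half: "(1/2::real) powr a < 1" using a using powr_less_mono2[of a "1/2" 1] by simp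
  have sg: "summable (\<lambda>k. ((1/2) powr a) ^ k)"
    using half by (intro summable_geometric) auto
  have sm: "summable (\<lambda>k. c k * m k)"
    unfolding cm using sg by (rule summable_mult)
  have key: "0 \<le> norm (x - y) powr (a - n) \<and> (\<exists>k. y \<in> ?S k \<and> norm (x - y) powr (a - n) \<le> c k)"
    if "y \<in> A" for y
  proof -
    have y: "0 < norm (x - y)" "norm (x - y) \<le> d" using that A(2) by (auto simp: dist_norm)
    obtain k where k: "d * (1/2) ^ Suc k < norm (x - y)" "norm (x - y) \<le> d * (1/2) ^ k"
      using ex_half_power[OF y] by blast
    let ?R = "d * (1/2) ^ k"
    have R: "0 < ?R" using d by simp
    \<comment> \<open>The sign of \<open>a - n\<close> is not known, so the exponent is split: the
      increasing factor is bounded at the outer radius, the decreasing one at the inner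
      radius.\<close>
    have "norm (x - y) powr (a - n) = norm (x - y) powr a * norm (x - y) powr (- n)"
      by (simp add: powr_add[symmetric])
    also have "\<dots> \<le> ?R powr a * (?R / 2) powr (- n)"
      using k y a by (intro mult_mono powr_mono2 powr_mono2') (auto simp: n_def)
    also have "\<dots> = c k"
    proof -
      have "(?R / 2) powr (- n) = 2 powr n * ?R powr (- n)"
        using R by (simp only: powr_divide powr_minus) (simp add: field_simps)
      moreover have "?R powr a * ?R powr (- n) = ?R powr (a - n)"
        by (simp add: powr_add[symmetric])
      ultimately show ?thesis unfolding c_def by (metis mult.left_commute)
    qed
    finally show ?thesis using k by (auto simp: dist_norm)
  qed
  have S: "?S k \<in> sets borel" "emeasure lborel (?S k) \<le> ennreal (m k)" for k
    using d by (auto simp: m_def n_def emeasure_cball)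
  have n0: "0 \<le> c k" "0 \<le> m k" for k using d by (auto simp: c_def m_def n_def)
  have meas: "(\<lambda>y. norm (x - y) powr (a - n)) \<in> borel_measurable borel" by measurable
  note r = integral_le_sum_cover[of ?S m c A, OF S n0 sm key A(1) meas]
  show "(\<lambda>y::'a. norm (x - y) powr (a - n)) integrable_on A" using r by simp
  have "integral A (\<lambda>y::'a. norm (x - y) powr (a - n)) \<le> (\<Sum>k. c k * m k)" using r by simp
  also have "\<dots> = 2 powr n * unit_ball_vol n * d powr a * (\<Sum>k. ((1/2) powr a) ^ k)"
    unfolding cm using sg by (rule suminf_mult)
  finally show "integral A (\<lambda>y::'a. norm (x - y) powr (a - n))
       \<le> 2 powr n * unit_ball_vol n * (\<Sum>k. ((1/2) powr a) ^ k) * d powr a"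
    by (simp add: mult_ac)
qed

text \<open>Dyadic shells growing outwards: the shell between the radii \<open>2 ^ k\<close> and
  \<open>2 ^ Suc k\<close> contributes a multiple of \<open>((1/2) powr a) ^ k\<close>. The index is
  found by applying \<open>ex_half_power\<close> to \<open>1 / norm y\<close>.\<close>

lemma integrable_powr_tail:
  fixes a :: real
  assumes a: "0 < a" and A: "A \<in> sets borel" "A \<inter> ball 0 1 = {}"
  shows "(\<lambda>y::'a::euclidean_space. norm y powr (- a - real DIM('a))) integrable_on A"
proof -
  define n where "n = real DIM('a)"
  let ?S = "\<lambda>k. cball (0::'a) (2 ^ Suc k)"
  define m where "m = (\<lambda>k::nat. unit_ball_vol n * (2 ^ Suc k) ^ DIM('a))"
  define c where "c = (\<lambda>k::nat. (2 ^ k) powr (- a - n))"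
  have cm: "c k * m k = unit_ball_vol n * 2 powr n * ((1/2) powr a) ^ k" for k
  proof -
    have "(2 ^ k) powr (- a - n) * ((2::real) ^ Suc k) ^ DIM('a) = 2 powr (real k * (-a - n)) * 2 powr (real (Suc k) * n)"
      by (simp add: n_def powr_realpow[symmetric] powr_powr del: power_Suc of_nat_Suc)
    also have "\<dots> = 2 powr n * 2 powr (- (a * k))"
      by (simp add: powr_add[symmetric] algebra_simps)
    also have "2 powr (- (a * k)) = ((1/2) powr a) ^ k"
      by (simp add: powr_minus_divide powr_realpow[symmetric] powr_powr powr_divide)
    finally show ?thesis by (simp add: c_def m_def mult_ac)
  qed
  have half: "(1/2::real) powr a < 1" using a using powr_less_mono2[of a "1/2" 1] by simp
  have sm: "summable (\<lambda>k. c k * m k)"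
    unfolding cm using half by (intro summable_mult summable_geometric) auto
  have key: "0 \<le> norm y powr (- a - n) \<and> (\<exists>k. y \<in> ?S k \<and> norm y powr (- a - n) \<le> c k)"
    if "y \<in> A" for y
  proof -
    have y: "1 \<le> norm y" using that A(2) by (auto simp: not_less)
    have "0 < 1 / norm y" "1 / norm y \<le> 1" using y by (auto intro: divide_le_eq_1[THEN iffD2])
    then obtain k where k: "1 * (1/2) ^ Suc k < 1 / norm y" "1 / norm y \<le> 1 * (1/2) ^ k"
      using ex_half_power by blast
    have "norm y \<le> 2 * 2 ^ k" 
    proof -
      have "1 / (2 * 2 ^ k) < 1 / norm y" using k(1) by (simp add: power_divide)
      moreover have "0 < norm y" using y by linarith
      ultimately show ?thesis by (simp add: frac_less2 divide_less_cancel field_simps)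
    qed
    hence "y \<in> ?S k" by simp
    moreover have "2 ^ k \<le> norm y"
    proof -
      have "1 / norm y \<le> 1 / 2 ^ k" using k(2) by (simp add: power_divide)
      moreover have "0 < norm y" using y by linarith
      ultimately show ?thesis by (simp add: field_simps)
    qed
    hence "norm y powr (- a - n) \<le> c k"
      unfolding c_def using a by (intro powr_mono2') (auto simp: n_def)
    ultimately show ?thesis by auto
  qed
  have S: "?S k \<in> sets borel" "emeasure lborel (?S k) \<le> ennreal (m k)" for k
    by (auto simp: m_def n_def emeasure_cball simp del: power_Suc)
  have n0: "0 \<le> c k" "0 \<le> m k" for k by (auto simp: c_def m_def n_def)
  have meas: "(\<lambda>y::'a. norm y powr (- a - n)) \<in> borel_measurable borel" by measurable
  show ?thesis 
    using integral_le_sum_cover(1)[of ?S m c A, OF S n0 sm key A(1) meas] by (simp add: n_def)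
qed

text \<open>The point reflection at \<open>x\<close> has Jacobian of modulus one and preserves
  Lebesgue measure, so the integral equals its own negative.\<close>

lemma has_integral_odd:
  fixes f :: "'a::euclidean_space \<Rightarrow> real"
  assumes odd: "\<And>y. y \<in> A \<Longrightarrow> 2 *\<^sub>R x - y \<in> A \<and> f (2 *\<^sub>R x - y) = - f y"
    and abs: "integrable lborel (\<lambda>y. indicator A y * f y)"
  shows "(f has_integral 0) A"
proof -
  let ?g = "\<lambda>y. indicator A y * f y"
  have g: "?g (2 *\<^sub>R x - y) = - ?g y" for y
  proof (cases "y \<in> A")
    case False
    hence "2 *\<^sub>R x - y \<notin> A" using odd[of "2 *\<^sub>R x - y"] by auto
    thus ?thesis using False by simp
  qed (use odd in auto)
  have "(lborel :: 'a measure) = density (distr lborel borel (\<lambda>y. 2 *\<^sub>R x + (-1) *\<^sub>R y)) (\<lambda>_. ennreal (\<bar>-1\<bar>^DIM('a)))"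
    using lborel_affine[of "-1" "2 *\<^sub>R x"] by simp
  hence lb: "(lborel :: 'a measure) = distr lborel borel (\<lambda>y. 2 *\<^sub>R x - y)"
    by (simp add: density_1)
  have "integral\<^sup>L lborel ?g = integral\<^sup>L (distr lborel borel (\<lambda>y. 2 *\<^sub>R x - y)) ?g"
    using lb by simp
  also have "\<dots> = integral\<^sup>L lborel (\<lambda>y. ?g (2 *\<^sub>R x - y))"
    by (rule integral_distr) (use abs in \<open>auto dest: borel_measurable_integrable\<close>)
  also have "\<dots> = - integral\<^sup>L lborel ?g" by (simp add: g)
  finally have "integral\<^sup>L lborel ?g = 0" by simp
  with has_integral_integral_lborel[OF abs] have "(?g has_integral 0) UNIV" by simp
  moreover have "?g = (\<lambda>y. if y \<in> A then f y else 0)" by (auto simp: indicator_def)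
  ultimately show ?thesis by (simp add: has_integral_restrict_UNIV)
qed

lemma integrable_on_compact:
  fixes f :: "'a::euclidean_space \<Rightarrow> real"
  assumes "compact A" "continuous_on A f"
  shows "f integrable_on A" "integrable lborel (\<lambda>y. indicator A y * f y)"
proof -
  have *: "integrable lborel (\<lambda>y. indicator A y * f y)"
    using borel_integrable_compact[OF assms] by simp
  show "integrable lborel (\<lambda>y. indicator A y * f y)" by (rule *)
  have "(\<lambda>y. indicator A y * f y) = (\<lambda>y. if y \<in> A then f y else 0)" by (auto simp: indicator_def)
  thus "f integrable_on A" using integrable_on_lborel[OF *] by (simp add: integrable_restrict_UNIV)
qed

text \<open>This symmetry removes the linear part of a paraboloid or of a Taylor expansion. Cutting
  out the ball of radius \<open>\<epsilon>\<close> makes the integrand continuous on a compact set,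
  hence integrable for every exponent \<open>p\<close>.\<close>

lemma has_integral_annulus_odd:
  fixes x b :: "'a::euclidean_space"
  assumes "0 < \<epsilon>"
  shows "((\<lambda>y. norm (x - y) powr p * (b \<bullet> (y - x))) has_integral 0) (cball x d - ball x \<epsilon>)"
proof -
  have cpt: "compact (cball x d - ball x \<epsilon>)" by (intro compact_diff) auto
  have cont: "continuous_on (cball x d - ball x \<epsilon>) (\<lambda>y. norm (x - y) powr p * (b \<bullet> (y - x)))"
    using assms by (intro continuous_intros) (auto simp: dist_norm)
  show ?thesis
  proof (rule has_integral_odd[where x = x])
    fix y assume y: "y \<in> cball x d - ball x \<epsilon>"
    have "x - (2 *\<^sub>R x - y) = - (x - y)" by (simp add: scaleR_2 algebra_simps)
    hence "norm (x - (2 *\<^sub>R x - y)) = norm (x - y)" by (metis norm_minus_cancel)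
    moreover have "(2 *\<^sub>R x - y) - x = - (y - x)" by (simp add: scaleR_2 algebra_simps)
    ultimately show "2 *\<^sub>R x - y \<in> cball x d - ball x \<epsilon> \<and>
        norm (x - (2 *\<^sub>R x - y)) powr p * (b \<bullet> (2 *\<^sub>R x - y - x)) = - (norm (x - y) powr p * (b \<bullet> (y - x)))"
      using y by (simp only: inner_minus_right) (simp add: dist_norm)
  qed (use integrable_on_compact[OF cpt cont] in auto)
qed

text \<open>The mean value theorem is applied to \<open>z powr (- q / 2)\<close> between
  \<open>a\<^sup>2\<close> and \<open>b\<^sup>2\<close>: for the kernel the difference of squares is
  an explicit product, while the difference of the norms is not.\<close>

lemma powr_neg_diff_bounds:
  fixes a b q :: real
  assumes "0 < a" "a < b" "0 < q"
  shows "(b\<^sup>2 - a\<^sup>2) * (q/2) * b powr (- q - 2) \<le> a powr (-q) - b powr (-q)"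
    "a powr (-q) - b powr (-q) \<le> (b\<^sup>2 - a\<^sup>2) * (q/2) * a powr (- q - 2)"
proof -
  have sq: "0 < a\<^sup>2" "a\<^sup>2 < b\<^sup>2" using assms by (auto intro: power_strict_mono)
  have pw: "(t\<^sup>2) powr (- r / 2) = t powr (- r)" if "0 < t" for t r :: real
  proof -
    have "t\<^sup>2 = t powr 2" using that by simp
    thus ?thesis by (simp only: powr_powr) simp
  qed
  have "\<exists>z. a\<^sup>2 < z \<and> z < b\<^sup>2 \<and> (b\<^sup>2) powr (-q/2) - (a\<^sup>2) powr (-q/2) = (b\<^sup>2 - a\<^sup>2) * ((-q/2) * z powr (-q/2 - 1))"
  proof (rule MVT2)
    fix z assume "a\<^sup>2 \<le> z"
    hence z: "z > 0" using sq by linarith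
    show "((\<lambda>x. x powr (-q/2)) has_real_derivative (-q/2) * z powr (-q/2 - 1)) (at z)"
      using z by (intro has_real_derivative_powr)
  qed (use sq in auto)
  then obtain z where z: "a\<^sup>2 < z" "z < b\<^sup>2"
    and eq: "(b\<^sup>2) powr (-q/2) - (a\<^sup>2) powr (-q/2) = (b\<^sup>2 - a\<^sup>2) * ((-q/2) * z powr (-q/2 - 1))" by blast
  have eq': "a powr (-q) - b powr (-q) = (b\<^sup>2 - a\<^sup>2) * (q/2) * z powr (-q/2 - 1)"
    using eq pw[of a q] pw[of b q] assms by simp
  have ex: "-q/2 - 1 = - (q + 2) / 2" by simp
  have "(b\<^sup>2) powr (-q/2 - 1) \<le> z powr (-q/2 - 1)" "z powr (-q/2 - 1) \<le> (a\<^sup>2) powr (-q/2 - 1)"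
    using z sq assms by (auto intro!: powr_mono2' order.strict_trans[OF sq(1)] zero_less_power)
  hence "b powr (- q - 2) \<le> z powr (-q/2 - 1)" "z powr (-q/2 - 1) \<le> a powr (- q - 2)"
    unfolding ex using pw[of a "q+2"] pw[of b "q+2"] assms by simp_all
  thus "(b\<^sup>2 - a\<^sup>2) * (q/2) * b powr (- q - 2) \<le> a powr (-q) - b powr (-q)"
    "a powr (-q) - b powr (-q) \<le> (b\<^sup>2 - a\<^sup>2) * (q/2) * a powr (- q - 2)"
    unfolding eq' using sq assms by (auto intro!: mult_left_mono)
qed

section \<open>The antisymmetric kernel\<close>

locale antisym_setting =
  fixes e :: "'a::euclidean_space" and s \<rho> :: real
  assumes e: "e \<in> Basis" and s: "0 < s" "s < 1" and rho: "0 < \<rho>" "\<rho> < 1"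
begin

definition q :: real where "q = real DIM('a) + 2 * s"

definition kern :: "'a \<Rightarrow> 'a \<Rightarrow> real" where
  "kern x y = norm (x - y) powr (- q) - norm (refl_e e x - y) powr (- q)"

definition wt :: "'a \<Rightarrow> real" where
  "wt y = (y \<bullet> e) / (1 + norm y powr (q + 2))"

lemma q_ge1: "1 \<le> q"
proof -
  have "1 \<le> real DIM('a)" using DIM_positive[where 'a='a] by linarith
  thus ?thesis unfolding q_def using s by linarith
qed

lemma norm_e [simp]: "norm e = 1" "e \<bullet> e = 1"
  using e by (auto simp: inner_same_Basis)

text \<open>The product of first coordinates found here is the source of the factor
  \<open>y \<bullet> e\<close> in the weight.\<close>

lemma norm_refl_sq: "(norm (refl_e e x - y))\<^sup>2 = (norm (x - y))\<^sup>2 + 4 * (x \<bullet> e) * (y \<bullet> e)"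
proof -
  have "(norm (refl_e e x - y))\<^sup>2 = ((x - y) - (2 * (x \<bullet> e)) *\<^sub>R e) \<bullet> ((x - y) - (2 * (x \<bullet> e)) *\<^sub>R e)"
    by (simp add: power2_norm_eq_inner refl_e_def algebra_simps)
  also have "\<dots> = (x - y) \<bullet> (x - y) - 4 * (x \<bullet> e) * ((x - y) \<bullet> e) + 4 * (x \<bullet> e)\<^sup>2"
    unfolding inner_diff_left[of "x - y"] inner_diff_right[of _ "x - y"]
    by (simp add: power2_eq_square inner_commute)
  also have "\<dots> = (norm (x - y))\<^sup>2 + 4 * (x \<bullet> e) * (y \<bullet> e)"
    by (simp add: power2_norm_eq_inner[symmetric] inner_diff_left power2_eq_square algebra_simps)
  finally show ?thesis .
qed

lemma norm_refl: "norm (refl_e e x) = norm x"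
  using norm_refl_sq[of x 0] by (simp add: power2_eq_iff_nonneg)

lemma refl_inner: "refl_e e x \<bullet> e = - (x \<bullet> e)"
  by (simp add: refl_e_def inner_diff_left)

text \<open>Reflection puts \<open>x\<close> across the hyperplane, so the reflected kernel term
  stays bounded as long as \<open>x\<close> keeps away from the boundary.\<close>

lemma norm_refl_ge:
  assumes "0 \<le> y \<bullet> e"
  shows "x \<bullet> e \<le> norm (refl_e e x - y)"
proof -
  have "x \<bullet> e \<le> \<bar>(refl_e e x - y) \<bullet> e\<bar>"
    using assms by (simp add: inner_diff_left refl_inner)
  also have "\<dots> \<le> norm (refl_e e x - y)" using e by (rule Basis_le_norm)
  finally show ?thesis .
qed

lemma ball_e:
  assumes "x \<in> ball e \<rho>"
  shows "1 - \<rho> < x \<bullet> e" "x \<bullet> e \<le> 2" "norm x \<le> 2" "x \<in> halfspace e"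
proof -
  have d: "norm (x - e) < \<rho>" using assms by (simp add: dist_norm norm_minus_commute)
  have "\<bar>(x - e) \<bullet> e\<bar> \<le> norm (x - e)" using e by (rule Basis_le_norm)
  hence *: "\<bar>x \<bullet> e - 1\<bar> < \<rho>" using d by (simp add: inner_diff_left)
  show "1 - \<rho> < x \<bullet> e" "x \<bullet> e \<le> 2" using * rho by auto
  show "x \<in> halfspace e" using * rho by (auto simp: halfspace_def)
  have "norm x \<le> norm (x - e) + norm e" using norm_triangle_sub by (metis add.commute)
  thus "norm x \<le> 2" using d rho by simp
qed

lemma norm_lt_refl:
  assumes "x \<in> halfspace e" "y \<in> halfspace e"
  shows "norm (x - y) < norm (refl_e e x - y)"
proof -
  have "(norm (x - y))\<^sup>2 < (norm (refl_e e x - y))\<^sup>2"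
    using assms by (simp add: norm_refl_sq halfspace_def)
  thus ?thesis by (rule power2_less_imp_less) simp
qed

text \<open>With \<open>a = norm (x - y)\<close> and \<open>b\<close> the distance from the
  reflected point, the difference of squares in \<open>powr_neg_diff_bounds\<close> is
  \<open>4 * (x \<bullet> e) * (y \<bullet> e)\<close>, and the factor \<open>q / 2\<close> turns 4
  into \<open>2 * q\<close>.\<close>

lemma kern_bounds:
  assumes "x \<in> halfspace e" "y \<in> halfspace e" "y \<noteq> x"
  shows "2 * q * (x \<bullet> e) * (y \<bullet> e) * norm (refl_e e x - y) powr (- q - 2) \<le> kern x y"
    "kern x y \<le> 2 * q * (x \<bullet> e) * (y \<bullet> e) * norm (x - y) powr (- q - 2)"
proof -
  have *: "0 < norm (x - y)" "norm (x - y) < norm (refl_e e x - y)" "0 < q"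
    using assms norm_lt_refl q_ge1 by auto
  from powr_neg_diff_bounds[OF *]
  show "2 * q * (x \<bullet> e) * (y \<bullet> e) * norm (refl_e e x - y) powr (- q - 2) \<le> kern x y"
    "kern x y \<le> 2 * q * (x \<bullet> e) * (y \<bullet> e) * norm (x - y) powr (- q - 2)"
    by (simp_all add: kern_def norm_refl_sq mult_ac)
qed

lemma kern_nonneg:
  assumes "x \<in> halfspace e" "y \<in> halfspace e" "y \<noteq> x"
  shows "0 \<le> kern x y"
proof -
  have "0 \<le> 2 * q * (x \<bullet> e) * (y \<bullet> e) * norm (refl_e e x - y) powr (- q - 2)"
    using assms q_ge1 by (simp add: halfspace_def)
  thus ?thesis using kern_bounds(1)[OF assms] by linarith
qed

section \<open>Integrability of the weight and its comparison with the kernel\<close>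

lemma wt_nonneg: "y \<in> halfspace e \<Longrightarrow> 0 \<le> wt y"
  by (auto simp: wt_def halfspace_def intro!: divide_nonneg_nonneg add_nonneg_nonneg)

text \<open>At infinity one power of \<open>norm y\<close> in the denominator is spent on the
  numerator \<open>y \<bullet> e\<close>; the remaining exponent is still below minus the dimension,
  which makes the tail integrable.\<close>

lemma wt_le:
  assumes "y \<in> halfspace e"
  shows "wt y \<le> 1" "1 \<le> norm y \<Longrightarrow> wt y \<le> norm y powr (- (1 + 2 * s) - real DIM('a))"
proof -
  have y: "0 < y \<bullet> e" "y \<bullet> e \<le> norm y"
    using assms Basis_le_norm[OF e, of y] by (auto simp: halfspace_def)
  have big: "norm y * norm y powr (q + 1) = norm y powr (q + 2)"
    using powr_add[of "norm y" 1 "q + 1"] y by (simp add: add.commute)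
  have "y \<bullet> e \<le> 1 + norm y powr (q + 2)"
  proof (cases "norm y \<le> 1")
    case False
    hence "norm y powr 1 \<le> norm y powr (q + 2)" using q_ge1 by (intro powr_mono) auto
    thus ?thesis using y False by simp
  qed (use y in \<open>auto intro: order_trans[of _ 1]\<close>)
  thus "wt y \<le> 1" unfolding wt_def by (intro divide_le_eq_1[THEN iffD2]) (auto intro: add_pos_nonneg)
  assume 1: "1 \<le> norm y"
  have "wt y \<le> norm y / norm y powr (q + 2)"
    unfolding wt_def using y 1 by (intro frac_le) auto
  also have "\<dots> = norm y powr (1 - (q + 2))"
    using powr_diff[of "norm y" 1 "q + 2"] y by simp
  also have "1 - (q + 2) = - (1 + 2 * s) - real DIM('a)" by (simp add: q_def)
  finally show "wt y \<le> norm y powr (- (1 + 2 * s) - real DIM('a))" .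
qed

lemma halfspace_borel [measurable]: "halfspace e \<in> sets borel"
  unfolding halfspace_def by measurable

text \<open>Needed for terms in which the fixed value \<open>u x\<close>, rather than
  \<open>u y\<close>, is multiplied by the kernel away from \<open>x\<close>.\<close>

lemma wt_integrable: "wt integrable_on halfspace e"
proof -
  have meas: "wt \<in> borel_measurable (lebesgue_on S)" for S
    by (rule measurable_restrict_space1, rule measurable_completion) (auto simp: wt_def[abs_def])
  have 1: "wt integrable_on (halfspace e \<inter> ball 0 1)"
  proof (rule measurable_bounded_by_integrable_imp_integrable[OF meas, where g="\<lambda>_. 1"])
    show "(\<lambda>_. 1::real) integrable_on (halfspace e \<inter> ball 0 1)"
      by (intro integrable_on_const) (subst Int_commute, intro fmeasurable_Int_fmeasurable, auto intro: sets_completionI_sets)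
  qed (use wt_nonneg wt_le in \<open>auto intro!: sets_completionI_sets\<close>)
  have 2: "wt integrable_on (halfspace e - ball 0 1)"
  proof (rule measurable_bounded_by_integrable_imp_integrable[OF meas])
    show "(\<lambda>y. norm y powr (- (1 + 2 * s) - real DIM('a))) integrable_on (halfspace e - ball 0 1)"
      by (rule integrable_powr_tail) (use s in auto)
  qed (use wt_nonneg wt_le in \<open>auto intro!: sets_completionI_sets\<close>)
  have "wt integrable_on ((halfspace e \<inter> ball 0 1) \<union> (halfspace e - ball 0 1))"
    by (rule integrable_Un[OF _ 1 2]) (auto intro: negligible_subset[of "{}"])
  also have "(halfspace e \<inter> ball 0 1) \<union> (halfspace e - ball 0 1) = halfspace e" by auto
  finally show ?thesis .
qed

text \<open>The lower bound in \<open>kern_bounds\<close> involves only the reflected distance,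
  which is at most \<open>2 + norm y\<close> and hence at most three times the larger of 1 and
  \<open>norm y\<close>. It therefore holds right up to the singularity.\<close>

lemma kern_lower: "\<exists>k>0. \<forall>x\<in>ball e \<rho>. \<forall>y\<in>halfspace e. y \<noteq> x \<longrightarrow> k * wt y \<le> kern x y"
proof (intro exI conjI ballI impI)
  define k where "k = 2 * q * (1 - \<rho>) * 3 powr (- q - 2)"
  show "0 < k" using q_ge1 rho by (simp add: k_def)
  fix x y assume x: "x \<in> ball e \<rho>" and y: "y \<in> halfspace e" "y \<noteq> x"
  note bx = ball_e[OF x]
  have y0: "0 < y \<bullet> e" using y by (simp add: halfspace_def)
  let ?b = "norm (refl_e e x - y)"
  have b0: "0 < ?b" using norm_lt_refl[OF bx(4) y(1)] norm_ge_zero[of "x - y"] by linarith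
  have b: "?b \<le> 2 + norm y" using norm_triangle_ineq4[of "refl_e e x" y] bx by (simp add: norm_refl)
  have den: "3 powr (- q - 2) / (1 + norm y powr (q + 2)) \<le> ?b powr (- q - 2)"
  proof (cases "norm y \<le> 1")
    case True
    have "3 powr (- q - 2) / (1 + norm y powr (q + 2)) \<le> 3 powr (- q - 2) / 1"
      by (intro divide_left_mono) (auto intro: add_pos_nonneg)
    also have "\<dots> \<le> ?b powr (- q - 2)" using b b0 True q_ge1 by (auto intro!: powr_mono2')
    finally show ?thesis .
  next
    case False
    have "3 powr (- q - 2) / (1 + norm y powr (q + 2)) \<le> 3 powr (- q - 2) / norm y powr (q + 2)"
      using False by (intro divide_left_mono mult_pos_pos) (auto intro: add_pos_nonneg)
    also have "\<dots> = (3 * norm y) powr (- q - 2)"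
      using powr_minus_divide[of "norm y" "q + 2"] by (simp add: powr_mult)
    also have "\<dots> \<le> ?b powr (- q - 2)" using b b0 False q_ge1 by (auto intro!: powr_mono2')
    finally show ?thesis .
  qed
  have "k * wt y = 2 * q * (1 - \<rho>) * (y \<bullet> e) * (3 powr (- q - 2) / (1 + norm y powr (q + 2)))"
    by (simp add: k_def wt_def)
  also have "\<dots> \<le> 2 * q * (x \<bullet> e) * (y \<bullet> e) * ?b powr (- q - 2)"
    using den bx y0 q_ge1 rho by (intro mult_mono) (auto intro!: mult_nonneg_nonneg divide_nonneg_nonneg add_nonneg_nonneg)
  also have "\<dots> \<le> kern x y" using kern_bounds(1)[OF bx(4) y] .
  finally show "k * wt y \<le> kern x y" .
qed

text \<open>Off the ball of radius \<open>\<delta>\<close> one has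
  \<open>norm y \<le> 3 * (norm (x - y) / \<delta>)\<close>, so the power \<open>- q - 2\<close> of
  the distance is comparable to the reciprocal of the denominator of \<open>wt\<close>. The loss
  \<open>\<delta> powr (- q - 2)\<close> is kept explicit because \<open>\<delta>\<close> is not
  fixed in the bound from above.\<close>

lemma kern_upper:
  "\<exists>C>0. \<forall>x\<in>ball e \<rho>. \<forall>y\<in>halfspace e. \<forall>\<delta>. 0 < \<delta> \<longrightarrow> \<delta> \<le> 1 \<longrightarrow> \<delta> \<le> norm (x - y)
     \<longrightarrow> kern x y \<le> C * \<delta> powr (- q - 2) * wt y"
proof (intro exI conjI ballI allI impI)
  \<comment> \<open>The factor \<open>4 * q\<close> is \<open>2 * q\<close> from
    \<open>kern_bounds\<close> times the bound 2 for \<open>x \<bullet> e\<close>.\<close>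
  define C where "C = 4 * q * (1 + 3 powr (q + 2))"
  show "0 < C" using q_ge1 by (simp add: C_def add_pos_nonneg)
  fix x y and \<delta> :: real
  assume x: "x \<in> ball e \<rho>" and y: "y \<in> halfspace e" and d: "0 < \<delta>" "\<delta> \<le> 1" "\<delta> \<le> norm (x - y)"
  note bx = ball_e[OF x]
  have y0: "0 < y \<bullet> e" using y by (simp add: halfspace_def)
  have yx: "y \<noteq> x" using d by auto
  let ?a = "norm (x - y)"
  have a1: "1 \<le> ?a / \<delta>" using d by simp
  have "norm y \<le> ?a + 2" using norm_triangle_ineq4[of x "x - y"] bx by simp
  also have "\<dots> \<le> ?a / \<delta> + 2 * (?a / \<delta>)"
  proof -
    have "?a * \<delta> \<le> ?a" using d by (intro mult_left_le) auto
    thus ?thesis using a1 d by (intro add_mono) (auto simp: pos_le_divide_eq)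
  qed
  finally have ny: "norm y \<le> 3 * (?a / \<delta>)" by simp
  have "1 + norm y powr (q + 2) \<le> (?a / \<delta>) powr (q + 2) + (3 * (?a / \<delta>)) powr (q + 2)"
    using a1 ny q_ge1 by (intro add_mono powr_mono2 ge_one_powr_ge_zero) auto
  also have "\<dots> = (1 + 3 powr (q + 2)) * (?a / \<delta>) powr (q + 2)"
    using d powr_mult[of 3 "?a / \<delta>" "q + 2"] by (simp add: algebra_simps)
  also have "(?a / \<delta>) powr (q + 2) = ?a powr (q + 2) * \<delta> powr (- q - 2)"
    using d powr_minus_divide[of \<delta> "q + 2"] by (simp add: powr_divide)
  finally have den: "1 + norm y powr (q + 2) \<le> (1 + 3 powr (q + 2)) * (?a powr (q + 2) * \<delta> powr (- q - 2))" .
  have inv: "?a powr (q + 2) * ?a powr (- q - 2) = 1"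
    using yx powr_add[of ?a "q + 2" "- q - 2"] by simp
  have pos: "0 < 1 + norm y powr (q + 2)" by (auto intro: add_pos_nonneg)
  have "?a powr (- q - 2) * (1 + norm y powr (q + 2)) \<le> ?a powr (- q - 2) * ((1 + 3 powr (q + 2)) * (?a powr (q + 2) * \<delta> powr (- q - 2)))"
    using den by (rule mult_left_mono) simp
  also have "\<dots> = (?a powr (q + 2) * ?a powr (- q - 2)) * (1 + 3 powr (q + 2)) * \<delta> powr (- q - 2)"
    by (simp only: mult_ac)
  finally have "?a powr (- q - 2) \<le> (1 + 3 powr (q + 2)) * \<delta> powr (- q - 2) / (1 + norm y powr (q + 2))"
    unfolding inv using pos by (simp add: pos_le_divide_eq)
  hence *: "4 * q * (y \<bullet> e) * ?a powr (- q - 2) \<le> 4 * q * (y \<bullet> e) * ((1 + 3 powr (q + 2)) * \<delta> powr (- q - 2) / (1 + norm y powr (q + 2)))"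
    using q_ge1 y0 by (intro mult_left_mono) auto
  have "kern x y \<le> 2 * q * (x \<bullet> e) * (y \<bullet> e) * ?a powr (- q - 2)" using kern_bounds(2)[OF bx(4) y yx] .
  also have "\<dots> \<le> 2 * q * 2 * (y \<bullet> e) * ?a powr (- q - 2)"
    using bx q_ge1 y0 by (intro mult_right_mono mult_left_mono) auto
  also have "\<dots> \<le> C * \<delta> powr (- q - 2) * wt y" using * by (simp add: C_def wt_def mult_ac)
  finally show "kern x y \<le> C * \<delta> powr (- q - 2) * wt y" .
qed

lemma refl_powr_le:
  assumes "x \<in> ball e \<rho>" "0 \<le> y \<bullet> e"
  shows "norm (refl_e e x - y) powr (- q) \<le> (1 - \<rho>) powr (- q)"
  using norm_refl_ge[OF assms(2), of x] ball_e[OF assms(1)] q_ge1 rho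
  by (intro powr_mono2') auto

text \<open>For such \<open>y\<close> the reflected point is at least twice as far from
  \<open>y\<close> as \<open>x\<close> is; since \<open>q \<ge> 1\<close>, its term is at most half
  of the singular one.\<close>

lemma kern_near:
  assumes x: "x \<in> ball e \<rho>" and y: "2 * norm (x - y) \<le> x \<bullet> e" "y \<noteq> x" "0 \<le> y \<bullet> e"
  shows "norm (x - y) powr (- q) / 2 \<le> kern x y"
proof -
  have "norm (refl_e e x - y) powr (- q) \<le> (2 * norm (x - y)) powr (- q)"
    using norm_refl_ge[OF y(3), of x] y q_ge1 by (intro powr_mono2') auto
  also have "\<dots> = 2 powr (- q) * norm (x - y) powr (- q)" by (simp add: powr_mult)
  also have "\<dots> \<le> 2 powr (- 1) * norm (x - y) powr (- q)"
    using q_ge1 by (intro mult_right_mono powr_mono) auto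
  finally show ?thesis by (simp add: kern_def powr_minus_divide)
qed

text \<open>The restriction \<open>2 * d \<le> 1 - \<rho>\<close> keeps the whole ball in the region
  where \<open>kern_near\<close> applies.\<close>

lemma cball_subset:
  assumes x: "x \<in> ball e \<rho>" and d: "2 * d \<le> 1 - \<rho>" and y: "y \<in> cball x d"
  shows "(1 - \<rho>) / 2 \<le> y \<bullet> e" "y \<in> halfspace e" "2 * norm (x - y) \<le> x \<bullet> e" "norm y \<le> 3"
proof -
  have xy: "norm (x - y) \<le> d" using y by (simp add: dist_norm)
  have "\<bar>(x - y) \<bullet> e\<bar> \<le> norm (x - y)" using e by (rule Basis_le_norm)
  hence *: "\<bar>x \<bullet> e - y \<bullet> e\<bar> \<le> d" using xy by (simp add: inner_diff_left)
  show 1: "(1 - \<rho>) / 2 \<le> y \<bullet> e" using * d ball_e[OF x] by (simp add: abs_le_iff field_simps)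
  show "y \<in> halfspace e" using 1 rho by (auto simp: halfspace_def)
  show "2 * norm (x - y) \<le> x \<bullet> e" using xy d ball_e[OF x] by linarith
  show "norm y \<le> 3" using norm_triangle_ineq4[of x "x - y"] ball_e[OF x] xy d rho by simp
qed

text \<open>Allows a plain multiple of \<open>u y\<close> near \<open>x\<close> to be absorbed into
  \<open>As_weight\<close>.\<close>

lemma wt_lower: "\<exists>k>0. \<forall>x\<in>ball e \<rho>. \<forall>d. 2 * d \<le> 1 - \<rho> \<longrightarrow> (\<forall>y\<in>cball x d. k \<le> wt y)"
proof (intro exI conjI ballI allI impI)
  define k where "k = ((1 - \<rho>) / 2) / (1 + 3 powr (q + 2))"
  show "0 < k" using rho by (simp add: k_def add_pos_nonneg)
  fix x y d assume h: "x \<in> ball e \<rho>" "2 * d \<le> 1 - \<rho>" "y \<in> cball x d"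
  show "k \<le> wt y"
    unfolding k_def wt_def using cball_subset[OF h] rho q_ge1
    by (intro frac_le add_left_mono powr_mono2) (auto intro: add_pos_nonneg)
qed


section \<open>Integrals over annuli and the singular part of the kernel\<close>

abbreviation ann :: "'a \<Rightarrow> real \<Rightarrow> real \<Rightarrow> 'a set" where
  "ann x d \<epsilon> \<equiv> cball x d - ball x \<epsilon>"

lemma frac_eq: "frac_kernel_integrand s e u x y = kern x y * (u x - u y)"
  by (simp add: frac_kernel_integrand_def kern_def q_def)

lemma As_weight_eq: "As_weight s e u y = wt y * \<bar>u y\<bar>"
  by (simp add: As_weight_def wt_def q_def)

text \<open>The constant is uniform in the centre and in the inner radius, so the bound survives the
  limit of vanishing inner radius.\<close>

lemma ann_powr:
  assumes "0 < a"
  shows "\<exists>C>0. \<forall>x d \<epsilon>. 0 < d \<longrightarrow> 0 < \<epsilon> \<longrightarrow>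
    (\<exists>I. ((\<lambda>y::'a. norm (x - y) powr (a - real DIM('a))) has_integral I) (ann x d \<epsilon>) \<and> I \<le> C * d powr a)"
proof -
  define C where "C = 2 powr (real DIM('a)) * unit_ball_vol (real DIM('a)) * (\<Sum>k. ((1/2) powr a) ^ k)"
  have "\<exists>I. ((\<lambda>y::'a. norm (x - y) powr (a - real DIM('a))) has_integral I) (ann x d \<epsilon>) \<and> I \<le> (\<bar>C\<bar> + 1) * d powr a"
    if "0 < d" "0 < \<epsilon>" for x d \<epsilon>
  proof -
    have A: "ann x d \<epsilon> \<in> sets borel" "ann x d \<epsilon> \<subseteq> cball x d - {x}" using that by auto
    note i = integral_cball_powr_le[OF assms that(1) A]
    have "C * d powr a \<le> (\<bar>C\<bar> + 1) * d powr a" by (intro mult_right_mono) auto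
    thus ?thesis using i unfolding C_def[symmetric]
      by (intro exI[of _ "integral (ann x d \<epsilon>) (\<lambda>y. norm (x - y) powr (a - real DIM('a)))"] conjI integrable_integral) auto
  qed
  thus ?thesis by (intro exI[of _ "\<bar>C\<bar> + 1"]) auto
qed

definition vol1 :: real where "vol1 = unit_ball_vol (real DIM('a))"

lemma vol1_pos: "0 < vol1" by (simp add: vol1_def)

lemma ann_const:
  assumes "0 < \<epsilon>" "\<epsilon> \<le> d"
  shows "((\<lambda>y. c) has_integral (vol1 * (d ^ DIM('a) - \<epsilon> ^ DIM('a)) * c)) (ann (x::'a) d \<epsilon>)"
proof -
  have "measure lebesgue (ann x d \<epsilon>) = measure lebesgue (cball x d) - measure lebesgue (ball x \<epsilon>)"
    using assms by (intro measurable_measure_Diff) (auto intro: fmeasurableD)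
  also have "\<dots> = vol1 * (d ^ DIM('a) - \<epsilon> ^ DIM('a))"
    using assms by (simp add: content_cball content_ball vol1_def algebra_simps)
  finally have m: "measure lebesgue (ann x d \<epsilon>) = vol1 * (d ^ DIM('a) - \<epsilon> ^ DIM('a))" .
  have "ann x d \<epsilon> \<in> lmeasurable" by (intro fmeasurable_Diff) (auto intro: fmeasurableD)
  hence "(indicat_real (ann x d \<epsilon>) has_integral (measure lebesgue (ann x d \<epsilon>))) UNIV"
    by (simp add: lmeasurable_iff_has_integral)
  moreover have "indicat_real (ann x d \<epsilon>) = (\<lambda>y. if y \<in> ann x d \<epsilon> then 1 else 0)"
    by (auto simp: indicator_def)
  ultimately have "((\<lambda>y. 1::real) has_integral (measure lebesgue (ann x d \<epsilon>))) (ann x d \<epsilon>)"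
    by (simp only: has_integral_restrict_UNIV)
  from has_integral_mult_right[OF this, of c] show ?thesis by (simp add: m mult.commute)
qed

text \<open>The discrepancy is the reflected term alone, which is bounded by
  \<open>(1 - \<rho>) powr (- q)\<close>. The odd cancellation of the singular part thus carries
  over to \<open>kern\<close> up to a bounded error.\<close>

lemma kern_affine:
  assumes x: "x \<in> ball e \<rho>" and d: "2 * d \<le> 1 - \<rho>" and y: "y \<in> cball x d"
  shows "\<bar>kern x y * (b \<bullet> (y - x)) - norm (x - y) powr (- q) * (b \<bullet> (y - x))\<bar>
      \<le> (1 - \<rho>) powr (- q) * norm b * d"
proof -
  have y0: "0 \<le> y \<bullet> e" using cball_subset[OF x d y] by (auto simp: halfspace_def)
  have "\<bar>b \<bullet> (y - x)\<bar> \<le> norm b * norm (y - x)" by (rule Cauchy_Schwarz_ineq2)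
  also have "\<dots> \<le> norm b * d" using y by (intro mult_left_mono) (auto simp: dist_norm norm_minus_commute)
  finally have B: "\<bar>b \<bullet> (y - x)\<bar> \<le> norm b * d" .
  have "kern x y * (b \<bullet> (y - x)) - norm (x - y) powr (- q) * (b \<bullet> (y - x))
      = - (norm (refl_e e x - y) powr (- q) * (b \<bullet> (y - x)))"
    by (simp add: kern_def algebra_simps)
  hence "\<bar>kern x y * (b \<bullet> (y - x)) - norm (x - y) powr (- q) * (b \<bullet> (y - x))\<bar>
      = norm (refl_e e x - y) powr (- q) * \<bar>b \<bullet> (y - x)\<bar>" by (simp add: abs_mult)
  also have "\<dots> \<le> (1 - \<rho>) powr (- q) * (norm b * d)"
    using B by (intro mult_mono refl_powr_le[OF x y0]) auto
  finally show ?thesis by (simp add: mult_ac)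
qed

lemma kern_le_powr: "kern x y \<le> norm (x - y) powr (- q)"
  by (simp add: kern_def)

text \<open>Since \<open>s < 1\<close>, the exponent \<open>2 - 2 * s\<close> is positive, so a
  quadratic error is integrable against the kernel.\<close>

lemma powr_q_square:
  assumes "y \<noteq> x"
  shows "norm (x - y) powr (- q) * (norm (y - x))\<^sup>2 = norm (x - y) powr ((2 - 2 * s) - real DIM('a))"
proof -
  have "norm (x - y) powr (- q) * (norm (y - x))\<^sup>2 = norm (x - y) powr (- q) * norm (x - y) powr 2"
    using assms by (simp add: norm_minus_commute)
  also have "\<dots> = norm (x - y) powr ((2 - 2 * s) - real DIM('a))"
    unfolding powr_add[symmetric] by (rule arg_cong[where f="\<lambda>t. _ powr t"]) (simp add: q_def)
  finally show ?thesis .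
qed

section \<open>Touching by paraboloids\<close>

text \<open>In the ball of radius \<open>\<delta>\<close> the paraboloid makes
  \<open>u x - u y\<close> plus its value nonnegative, so the kernel in front of this sum may be
  lowered to the constant \<open>\<delta> powr (- q) / 2\<close>; integrating \<open>u x\<close>
  against that constant produces the gain. Outside, \<open>kern x y * u x\<close> has a good sign
  and \<open>kern x y * u y\<close> is paid for by \<open>As_norm\<close>. The constants are chosen
  before \<open>\<delta>\<close>, whose size is dictated later by the position of the touching
  point.\<close>

lemma upper_touch:
  "\<exists>c>0. \<exists>C>0. \<forall>x\<in>ball e \<rho>. \<forall>u b A \<delta> \<epsilon>.
    (\<forall>y\<in>halfspace e. 0 \<le> u y) \<longrightarrow> As_weight s e u integrable_on halfspace e \<longrightarrow>
    0 < \<delta> \<longrightarrow> 2 * \<delta> \<le> 1 - \<rho> \<longrightarrow> 0 < \<epsilon> \<longrightarrow> 2 * \<epsilon> \<le> \<delta> \<longrightarrow> 0 \<le> A \<longrightarrow>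
    (\<forall>y\<in>cball x \<delta>. u y - u x \<le> b \<bullet> (y - x) + A * (norm (y - x))\<^sup>2) \<longrightarrow>
    frac_kernel_integrand s e u x integrable_on (halfspace e - ball x \<epsilon>) \<longrightarrow>
    c * u x * \<delta> powr (- 2 * s) - C * A * \<delta> powr (2 - 2 * s) - C * norm b * \<delta>
      - C * \<delta> powr (- q - 2) * As_norm s e u
    \<le> integral (halfspace e - ball x \<epsilon>) (frac_kernel_integrand s e u x)"
proof -
  obtain C0 where C0: "0 < C0" and C0': "\<And>x d \<epsilon>. 0 < d \<Longrightarrow> 0 < \<epsilon> \<Longrightarrow>
    (\<exists>I. ((\<lambda>y::'a. norm (x - y) powr ((2 - 2 * s) - real DIM('a))) has_integral I) (ann x d \<epsilon>) \<and> I \<le> C0 * d powr (2 - 2 * s))"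
    using ann_powr[of "2 - 2 * s"] s by auto
  obtain C1 where C1: "0 < C1" and C1': "\<And>x y \<delta>. x \<in> ball e \<rho> \<Longrightarrow> y \<in> halfspace e \<Longrightarrow> 0 < \<delta> \<Longrightarrow> \<delta> \<le> 1 \<Longrightarrow>
      \<delta> \<le> norm (x - y) \<Longrightarrow> kern x y \<le> C1 * \<delta> powr (- q - 2) * wt y"
    using kern_upper by blast
  obtain k where k: "0 < k" and k': "\<And>x d y. x \<in> ball e \<rho> \<Longrightarrow> 2 * d \<le> 1 - \<rho> \<Longrightarrow> y \<in> cball x d \<Longrightarrow> k \<le> wt y"
    using wt_lower by blast
  define \<sigma> where "\<sigma> = (1 - \<rho>) powr (- q)"
  have sig: "0 \<le> \<sigma>" by (simp add: \<sigma>_def)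
  \<comment> \<open>The summand \<open>C1\<close> pays for \<open>u y\<close> outside the ball,
    \<open>1 / (2 * k)\<close> for the multiple \<open>m * u y\<close> left over inside it.\<close>
  define C2 where "C2 = C1 + 1 / (2 * k)"
  have C2: "0 < C2" using C1 k by (simp add: C2_def add_pos_nonneg)
  define C where "C = \<sigma> * vol1 + C0 + C2"
  have sv: "0 \<le> \<sigma> * vol1" using sig vol1_pos by simp
  have Cp: "0 < C" using sv C0 C2 by (simp add: C_def)
  have "vol1 / 4 * u x * \<delta> powr (- 2 * s) - C * A * \<delta> powr (2 - 2 * s) - C * norm b * \<delta>
      - C * \<delta> powr (- q - 2) * As_norm s e u
    \<le> integral (halfspace e - ball x \<epsilon>) (frac_kernel_integrand s e u x)"
    if x: "x \<in> ball e \<rho>" and u0: "\<forall>y\<in>halfspace e. 0 \<le> u y" and ui: "As_weight s e u integrable_on halfspace e"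
      and d: "0 < \<delta>" "2 * \<delta> \<le> 1 - \<rho>" and ep: "0 < \<epsilon>" "2 * \<epsilon> \<le> \<delta>" and A: "0 \<le> A"
      and touch: "\<forall>y\<in>cball x \<delta>. u y - u x \<le> b \<bullet> (y - x) + A * (norm (y - x))\<^sup>2"
      and fi: "frac_kernel_integrand s e u x integrable_on (halfspace e - ball x \<epsilon>)"
    for x u b A \<delta> \<epsilon>
  proof -
    let ?D = "halfspace e - ball x \<epsilon>"
    let ?A = "ann x \<delta> \<epsilon>"
    define U where "U = u x"
    define m where "m = \<delta> powr (- q) / 2"
    define J where "J = As_norm s e u"
    have U0: "0 \<le> U" using u0 ball_e[OF x] by (simp add: U_def)
    have m0: "0 \<le> m" by (simp add: m_def)
    have d1: "\<delta> \<le> 1" using d rho by simp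
    have AD: "?A \<subseteq> ?D" using cball_subset(2)[OF x d(2)] by auto
    have wtu: "As_weight s e u y = wt y * u y" if "y \<in> halfspace e" for y
      using u0 that by (simp add: As_weight_eq)
    define T where "T = \<delta> powr (- q - 2)"
    have T0: "0 \<le> T" by (simp add: T_def)
    have mT: "2 * m \<le> T" unfolding m_def T_def using d d1 by (simp add: powr_mono')
    \<comment> \<open>The factor \<open>norm (x - y) powr 0\<close> equals 1 off \<open>x\<close>
      and brings the linear term into the form required by \<open>has_integral_annulus_odd\<close>.
      Both linear terms integrate to zero.\<close>
    define g1 where "g1 = (\<lambda>y. (m * U - \<sigma> * norm b * \<delta>) + m * (norm (x - y) powr 0 * (b \<bullet> (y - x)))
        - norm (x - y) powr (- q) * (b \<bullet> (y - x)) - A * norm (x - y) powr ((2 - 2 * s) - real DIM('a)))"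
    define g where "g = (\<lambda>y. (if y \<in> ?A then g1 y else 0) - C2 * T * As_weight s e u y)"
    have le: "g y \<le> frac_kernel_integrand s e u x y" if y: "y \<in> ?D" for y
    proof (cases "y \<in> ?A")
      case True
      have yb: "y \<in> cball x \<delta>" "y \<noteq> x" using True ep by auto
      note cs = cball_subset[OF x d(2) yb(1)]
      define K where "K = kern x y"
      define r where "r = norm (x - y)"
      define B where "B = b \<bullet> (y - x)"
      define R where "R = norm (x - y) powr ((2 - 2 * s) - real DIM('a))"
      have r: "0 < r" "r \<le> \<delta>" using yb by (auto simp: r_def dist_norm)
      have "m \<le> r powr (- q) / 2"
        unfolding m_def using r q_ge1 by (intro divide_right_mono powr_mono2') auto
      also have "\<dots> \<le> K" using kern_near[OF x cs(3) yb(2)] cs(1) rho by (simp add: r_def K_def)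
      finally have mK: "m \<le> K" .
      have q0: "0 \<le> U - u y + (B + A * (norm (y - x))\<^sup>2)" using bspec[OF touch yb(1)] by (simp add: U_def B_def)
      \<comment> \<open>Lowering the kernel to \<open>m\<close> is legitimate for this nonnegative
        combination, not for \<open>U - u y\<close> itself.\<close>
      have 1: "m * (U - u y + (B + A * (norm (y - x))\<^sup>2)) \<le> K * (U - u y + (B + A * (norm (y - x))\<^sup>2))"
        using mK q0 by (rule mult_right_mono)
      have "K * (norm (y - x))\<^sup>2 \<le> r powr (- q) * (norm (y - x))\<^sup>2"
        unfolding K_def r_def by (intro mult_right_mono kern_le_powr) auto
      hence "K * (norm (y - x))\<^sup>2 \<le> R" unfolding r_def R_def using powr_q_square[OF yb(2)] by simp
      hence 2: "A * (K * (norm (y - x))\<^sup>2) \<le> A * R" using A by (rule mult_left_mono)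
      have 3: "\<bar>K * B - r powr (- q) * B\<bar> \<le> \<sigma> * norm b * \<delta>"
        unfolding K_def r_def B_def \<sigma>_def by (rule kern_affine[OF x d(2) yb(1)])
      have 4: "0 \<le> m * (A * (norm (y - x))\<^sup>2)" using m0 A by simp
      have "k \<le> wt y" using k'[OF x d(2) yb(1)] .
      hence "m * 1 \<le> m * (wt y / k)" using k m0 by (intro mult_left_mono) auto
      also have "\<dots> \<le> (T / 2) * (wt y / k)" using mT k wt_nonneg[OF cs(2)] by (intro mult_right_mono) auto
      also have "\<dots> \<le> C2 * T * wt y"
        using C1 T0 wt_nonneg[OF cs(2)] by (simp add: C2_def algebra_simps)
      finally have "m \<le> C2 * T * wt y" by simp
      hence 5: "m * u y \<le> C2 * T * wt y * u y" using u0 cs by (intro mult_right_mono) auto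
      have "g y = (m * U - \<sigma> * norm b * \<delta>) + m * B - r powr (- q) * B - A * R - C2 * T * wt y * u y"
        using True cs(2) yb by (simp add: g_def g1_def r_def B_def R_def wtu mult.assoc)
      also have "\<dots> \<le> K * (U - u y)"
        using 1 2 3 4 5 by (simp add: algebra_simps abs_le_iff)
      finally show ?thesis by (simp add: frac_eq K_def U_def)
    next
      case False
      have yH: "y \<in> halfspace e" and far: "\<delta> \<le> norm (x - y)" using y False by (auto simp: dist_norm)
      have yx: "y \<noteq> x" using far d by auto
      have kn: "0 \<le> kern x y" using kern_nonneg[OF ball_e(4)[OF x] yH yx] .
      have "kern x y \<le> C1 * T * wt y" unfolding T_def by (rule C1'[OF x yH d(1) d1 far])
      also have "\<dots> \<le> C2 * T * wt y" using T0 wt_nonneg[OF yH] k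
        by (intro mult_right_mono) (auto simp: C2_def)
      finally have "kern x y * u y \<le> C2 * T * wt y * u y" using u0 yH by (intro mult_right_mono) auto
      moreover have "0 \<le> kern x y * U" using kn U0 by simp
      moreover have "g y = 0 - C2 * T * As_weight s e u y"
        unfolding g_def by (simp only: False if_False)
      ultimately show ?thesis using yH
        by (simp add: wtu frac_eq U_def algebra_simps)
    qed
    obtain I where I: "((\<lambda>y::'a. norm (x - y) powr ((2 - 2 * s) - real DIM('a))) has_integral I) ?A" "I \<le> C0 * \<delta> powr (2 - 2 * s)"
      using C0'[OF d(1) ep(1)] by blast
    define v where "v = vol1 * (\<delta> ^ DIM('a) - \<epsilon> ^ DIM('a))"
    have g1: "(g1 has_integral (v * (m * U - \<sigma> * norm b * \<delta>) + m * 0 - 0 - A * I)) ?A"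
      unfolding g1_def v_def using d ep
      by (intro has_integral_diff has_integral_add has_integral_mult_right ann_const
          has_integral_annulus_odd I) auto
    have uD: "As_weight s e u integrable_on ?D"
    proof -
      have "As_weight s e u absolutely_integrable_on halfspace e"
        using ui u0 wt_nonneg by (intro nonnegative_absolutely_integrable_1) (auto simp: As_weight_eq)
      hence "As_weight s e u absolutely_integrable_on ?D"
        by (rule set_integrable_subset) (auto intro!: sets_completionI_sets)
      thus ?thesis by (rule set_lebesgue_integral_eq_integral(1))
    qed
    define JD where "JD = integral ?D (As_weight s e u)"
    have JD: "JD \<le> J" unfolding JD_def J_def As_norm_def using wt_nonneg uD ui
      by (intro integral_subset_le) (auto simp: As_weight_eq)
    have gI: "(g has_integral (v * (m * U - \<sigma> * norm b * \<delta>) + m * 0 - 0 - A * I - C2 * T * JD)) ?D"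
      unfolding g_def
    proof (rule has_integral_diff)
      show "((\<lambda>y. if y \<in> ?A then g1 y else 0) has_integral (v * (m * U - \<sigma> * norm b * \<delta>) + m * 0 - 0 - A * I)) ?D"
        using g1 by (subst has_integral_restrict[OF AD])
      show "((\<lambda>y. C2 * T * As_weight s e u y) has_integral C2 * T * JD) ?D"
        unfolding JD_def by (intro has_integral_mult_right integrable_integral uD)
    qed
    have main: "v * (m * U - \<sigma> * norm b * \<delta>) - A * I - C2 * T * JD \<le> integral ?D (frac_kernel_integrand s e u x)"
      using has_integral_le[OF gI integrable_integral[OF fi] le] by simp
    \<comment> \<open>The removed ball has at most half the radius, so in every dimension at least
      half of the volume remains.\<close>
    have "\<epsilon> ^ DIM('a) \<le> (\<delta> / 2) ^ DIM('a)" using ep d by (intro power_mono) auto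
    also have "\<dots> = \<delta> ^ DIM('a) * (1/2) ^ DIM('a)" by (simp add: power_divide)
    also have "\<dots> \<le> \<delta> ^ DIM('a) * (1/2) ^ 1"
      using d DIM_positive[where 'a='a] by (intro mult_left_mono power_decreasing) (auto simp: Suc_le_eq)
    finally have "\<delta> ^ DIM('a) / 2 \<le> \<delta> ^ DIM('a) - \<epsilon> ^ DIM('a)" by simp
    hence v1: "vol1 * \<delta> ^ DIM('a) / 2 \<le> v" unfolding v_def using vol1_pos by (simp add: field_simps)
    have "\<delta> ^ DIM('a) \<le> 1" using d d1 by (intro power_le_one) auto
    moreover have "0 \<le> \<epsilon> ^ DIM('a)" using ep by simp
    ultimately have "\<delta> ^ DIM('a) - \<epsilon> ^ DIM('a) \<le> 1" by linarith
    hence v2: "v \<le> vol1" unfolding v_def using vol1_pos mult_left_mono[of "\<delta> ^ DIM('a) - \<epsilon> ^ DIM('a)" 1 vol1] by simp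
    \<comment> \<open>The volume factor reduces the exponent \<open>- q\<close> to
      \<open>- 2 * s\<close>; the halves in \<open>m\<close> and in the volume bound combine to
      \<open>vol1 / 4\<close>.\<close>
    have mv: "m * \<delta> ^ DIM('a) = \<delta> powr (- 2 * s) / 2"
    proof -
      have "\<delta> powr (- q) * \<delta> powr (real DIM('a)) = \<delta> powr (- 2 * s)"
        unfolding powr_add[symmetric] by (rule arg_cong[where f="\<lambda>t. _ powr t"]) (simp add: q_def)
      thus ?thesis using d by (simp add: m_def powr_realpow)
    qed
    have "vol1 * \<delta> ^ DIM('a) / 2 * (m * U) \<le> v * (m * U)" using v1 m0 U0 by (intro mult_right_mono) auto
    moreover have "vol1 * \<delta> ^ DIM('a) / 2 * (m * U) = vol1 / 4 * U * \<delta> powr (- 2 * s)"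
    proof -
      have "vol1 * \<delta> ^ DIM('a) / 2 * (m * U) = vol1 / 2 * U * (m * \<delta> ^ DIM('a))" by simp
      thus ?thesis unfolding mv by simp
    qed
    ultimately have t1: "vol1 / 4 * U * \<delta> powr (- 2 * s) \<le> v * (m * U)" by linarith
    have "v * (\<sigma> * norm b * \<delta>) \<le> vol1 * (\<sigma> * norm b * \<delta>)" using v2 sig d by (intro mult_right_mono) auto
    also have "\<dots> = (\<sigma> * vol1) * (norm b * \<delta>)" by simp
    also have "\<dots> \<le> C * (norm b * \<delta>)" using C0 C2 d by (intro mult_right_mono) (auto simp: C_def)
    finally have t2: "v * (\<sigma> * norm b * \<delta>) \<le> C * (norm b * \<delta>)" .
    have "A * I \<le> A * (C0 * \<delta> powr (2 - 2 * s))" using I A by (intro mult_left_mono) auto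
    also have "\<dots> \<le> A * (C * \<delta> powr (2 - 2 * s))" using A sv C2
      by (intro mult_left_mono mult_right_mono) (auto simp: C_def)
    finally have t3: "A * I \<le> A * (C * \<delta> powr (2 - 2 * s))" .
    have J0: "0 \<le> J" unfolding J_def As_norm_def
      using wt_nonneg ui by (intro integral_nonneg) (auto simp: As_weight_eq)
    have "C2 * T * JD \<le> C2 * T * J" using C2 T0 JD by (intro mult_left_mono) auto
    also have "\<dots> \<le> C * T * J" using sv C0 T0 J0 by (intro mult_right_mono) (auto simp: C_def)
    finally have t4: "C2 * T * JD \<le> C * T * J" .
    show ?thesis using main t1 t2 t3 t4 unfolding U_def[symmetric] T_def[symmetric] J_def[symmetric]
      by (simp add: algebra_simps)
  qed
  thus ?thesis using Cp vol1_pos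
    by (intro exI[of _ "vol1 / 4"] conjI exI[of _ C]) auto
qed

text \<open>Now \<open>u y - u x\<close> plus the paraboloid is nonnegative in the ball. The kernel
  in front of it is lowered to \<open>k * wt y\<close> rather than to a constant, so that the same
  bound serves inside and outside the ball and leaves \<open>As_weight\<close> with a negative sign
  everywhere. Since \<open>\<delta>\<close> is fixed beforehand, its powers disappear in the
  constants.\<close>

lemma lower_touch:
  assumes d: "0 < \<delta>" "2 * \<delta> \<le> 1 - \<rho>"
  shows "\<exists>k>0. \<exists>C>0. \<forall>x\<in>ball e \<rho>. \<forall>u b A \<epsilon>.
    (\<forall>y\<in>halfspace e. 0 \<le> u y) \<longrightarrow> As_weight s e u integrable_on halfspace e \<longrightarrow>
    0 < \<epsilon> \<longrightarrow> \<epsilon> \<le> \<delta> \<longrightarrow> 0 \<le> A \<longrightarrow>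
    (\<forall>y\<in>cball x \<delta>. u x - u y \<le> b \<bullet> (y - x) + A * (norm (y - x))\<^sup>2) \<longrightarrow>
    frac_kernel_integrand s e u x integrable_on (halfspace e - ball x \<epsilon>) \<longrightarrow>
    integral (halfspace e - ball x \<epsilon>) (frac_kernel_integrand s e u x)
      \<le> C * (u x + A + norm b) - k * integral (halfspace e - ball x \<epsilon>) (As_weight s e u)"
proof -
  obtain C0 where C0: "0 < C0" and C0': "\<And>x d \<epsilon>. 0 < d \<Longrightarrow> 0 < \<epsilon> \<Longrightarrow>
    (\<exists>I. ((\<lambda>y::'a. norm (x - y) powr ((2 - 2 * s) - real DIM('a))) has_integral I) (ann x d \<epsilon>) \<and> I \<le> C0 * d powr (2 - 2 * s))"
    using ann_powr[of "2 - 2 * s"] s by auto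
  obtain C1 where C1: "0 < C1" and C1': "\<And>x y \<delta>. x \<in> ball e \<rho> \<Longrightarrow> y \<in> halfspace e \<Longrightarrow> 0 < \<delta> \<Longrightarrow> \<delta> \<le> 1 \<Longrightarrow>
      \<delta> \<le> norm (x - y) \<Longrightarrow> kern x y \<le> C1 * \<delta> powr (- q - 2) * wt y"
    using kern_upper by blast
  obtain k where k: "0 < k" and k': "\<And>x y. x \<in> ball e \<rho> \<Longrightarrow> y \<in> halfspace e \<Longrightarrow> y \<noteq> x \<Longrightarrow> k * wt y \<le> kern x y"
    using kern_lower by blast
  define \<sigma> where "\<sigma> = (1 - \<rho>) powr (- q)"
  have sig: "0 \<le> \<sigma>" by (simp add: \<sigma>_def)
  define T where "T = \<delta> powr (- q - 2)"
  have T0: "0 \<le> T" by (simp add: T_def)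
  define W where "W = integral (halfspace e) wt"
  have W0: "0 \<le> W" unfolding W_def using wt_nonneg by (intro integral_nonneg wt_integrable) auto
  have d1: "\<delta> \<le> 1" using d rho by simp
  define Ca where "Ca = k * vol1 + C1 * T * W"
  define Cb where "Cb = (k + \<sigma>) * vol1"
  define C where "C = Ca + Cb + C0"
  have Ca: "0 \<le> Ca" and Cb: "0 \<le> Cb"
    unfolding Ca_def Cb_def using k vol1_pos C1 T0 W0 sig by (auto intro!: add_nonneg_nonneg)
  have Cp: "0 < C" using Ca Cb C0 by (simp add: C_def)
  have "integral (halfspace e - ball x \<epsilon>) (frac_kernel_integrand s e u x)
      \<le> C * (u x + A + norm b) - k * integral (halfspace e - ball x \<epsilon>) (As_weight s e u)"
    if x: "x \<in> ball e \<rho>" and u0: "\<forall>y\<in>halfspace e. 0 \<le> u y" and ui: "As_weight s e u integrable_on halfspace e"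
      and ep: "0 < \<epsilon>" "\<epsilon> \<le> \<delta>" and A: "0 \<le> A"
      and touch: "\<forall>y\<in>cball x \<delta>. u x - u y \<le> b \<bullet> (y - x) + A * (norm (y - x))\<^sup>2"
      and fi: "frac_kernel_integrand s e u x integrable_on (halfspace e - ball x \<epsilon>)"
    for x u b A \<epsilon>
  proof -
    let ?D = "halfspace e - ball x \<epsilon>"
    let ?A = "ann x \<delta> \<epsilon>"
    define U where "U = u x"
    have U0: "0 \<le> U" using u0 ball_e[OF x] by (simp add: U_def)
    have AD: "?A \<subseteq> ?D" using cball_subset(2)[OF x d(2)] by auto
    have wtu: "As_weight s e u y = wt y * u y" if "y \<in> halfspace e" for y
      using u0 that by (simp add: As_weight_eq)
    \<comment> \<open>In the constant part, \<open>k * norm b * \<delta>\<close> bounds the linear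
      term tested against \<open>k * wt\<close>, and \<open>\<sigma> * norm b * \<delta>\<close> is
      the error from \<open>kern_affine\<close>.\<close>
    define g1 where "g1 = (\<lambda>y. (k * U + (k + \<sigma>) * norm b * \<delta>)
        + norm (x - y) powr (- q) * (b \<bullet> (y - x)) + A * norm (x - y) powr ((2 - 2 * s) - real DIM('a)))"
    define g where "g = (\<lambda>y. (if y \<in> ?A then g1 y else 0) + C1 * T * U * wt y - k * As_weight s e u y)"
    have le: "frac_kernel_integrand s e u x y \<le> g y" if y: "y \<in> ?D" for y
    proof (cases "y \<in> ?A")
      case True
      have yb: "y \<in> cball x \<delta>" "y \<noteq> x" using True ep by auto
      note cs = cball_subset[OF x d(2) yb(1)]
      define K where "K = kern x y"
      define r where "r = norm (x - y)"
      define B where "B = b \<bullet> (y - x)"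
      define R where "R = norm (x - y) powr ((2 - 2 * s) - real DIM('a))"
      have r: "0 < r" "r \<le> \<delta>" using yb by (auto simp: r_def dist_norm)
      have mK: "k * wt y \<le> K" using k'[OF x cs(2) yb(2)] by (simp add: K_def)
      have w: "0 \<le> wt y" "wt y \<le> 1" using wt_nonneg[OF cs(2)] wt_le[OF cs(2)] by auto
      define Q where "Q = B + A * (norm (y - x))\<^sup>2"
      have q0: "0 \<le> u y - U + Q" using bspec[OF touch yb(1)] by (simp add: U_def B_def Q_def)
      have 1: "k * wt y * (u y - U + Q) \<le> K * (u y - U + Q)"
        using mK q0 by (rule mult_right_mono)
      have "\<bar>B\<bar> \<le> norm b * norm (y - x)" unfolding B_def by (rule Cauchy_Schwarz_ineq2)
      also have "\<dots> \<le> norm b * \<delta>" using yb by (intro mult_left_mono) (auto simp: dist_norm norm_minus_commute)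
      finally have B: "\<bar>B\<bar> \<le> norm b * \<delta>" .
      \<comment> \<open>\<open>Q\<close> may be negative through its linear part, which has to be
        estimated; only its quadratic part can be discarded.\<close>
      have "0 \<le> A * (norm (y - x))\<^sup>2" using A by simp
      hence "U - Q \<le> U + norm b * \<delta>" using B by (simp add: Q_def abs_le_iff)
      hence "wt y * (U - Q) \<le> wt y * (U + norm b * \<delta>)" using w by (intro mult_left_mono) auto
      also have "\<dots> \<le> 1 * (U + norm b * \<delta>)" using w U0 d by (intro mult_right_mono) auto
      finally have "k * (wt y * (U - Q)) \<le> k * (U + norm b * \<delta>)" using k by (intro mult_left_mono) auto
      hence 4: "k * wt y * U - k * wt y * Q \<le> k * U + k * norm b * \<delta>" by (simp add: algebra_simps)
      have "K * (norm (y - x))\<^sup>2 \<le> r powr (- q) * (norm (y - x))\<^sup>2"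
        unfolding K_def r_def by (intro mult_right_mono kern_le_powr) auto
      hence "K * (norm (y - x))\<^sup>2 \<le> R" unfolding r_def R_def using powr_q_square[OF yb(2)] by simp
      hence 2: "A * (K * (norm (y - x))\<^sup>2) \<le> A * R" using A by (rule mult_left_mono)
      have 3: "\<bar>K * B - r powr (- q) * B\<bar> \<le> \<sigma> * norm b * \<delta>"
        unfolding K_def r_def B_def \<sigma>_def by (rule kern_affine[OF x d(2) yb(1)])
      have KQ: "K * Q = K * B + A * (K * (norm (y - x))\<^sup>2)" by (simp add: Q_def algebra_simps)
      have 5: "K * Q \<le> r powr (- q) * B + \<sigma> * norm b * \<delta> + A * R" unfolding KQ using 2 3 by (simp add: abs_le_iff)
      have 6: "0 \<le> C1 * T * U * wt y" using C1 T0 U0 w by simp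
      have "K * (U - u y) \<le> (k * U + (k + \<sigma>) * norm b * \<delta>) + r powr (- q) * B + A * R + C1 * T * U * wt y - k * wt y * u y"
        using 1 4 5 6 by (simp add: algebra_simps)
      also have "\<dots> = g y"
        using True cs(2) yb by (simp add: g_def g1_def r_def B_def R_def wtu mult.assoc)
      finally show ?thesis by (simp add: frac_eq K_def U_def)
    next
      case False
      have yH: "y \<in> halfspace e" and far: "\<delta> \<le> norm (x - y)" using y False by (auto simp: dist_norm)
      have yx: "y \<noteq> x" using far d by auto
      have "kern x y \<le> C1 * T * wt y" unfolding T_def by (rule C1'[OF x yH d(1) d1 far])
      hence "kern x y * U \<le> C1 * T * wt y * U" using U0 by (rule mult_right_mono)
      moreover have "k * wt y * u y \<le> kern x y * u y" using k'[OF x yH yx] u0 yH by (intro mult_right_mono) auto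
      moreover have "g y = 0 + C1 * T * U * wt y - k * As_weight s e u y"
        unfolding g_def by (simp only: False if_False)
      ultimately show ?thesis using yH
        by (simp add: wtu frac_eq U_def algebra_simps)
    qed
    obtain I where I: "((\<lambda>y::'a. norm (x - y) powr ((2 - 2 * s) - real DIM('a))) has_integral I) ?A" "I \<le> C0 * \<delta> powr (2 - 2 * s)"
      using C0'[OF d(1) ep(1)] by blast
    define v where "v = vol1 * (\<delta> ^ DIM('a) - \<epsilon> ^ DIM('a))"
    have g1: "(g1 has_integral (v * (k * U + (k + \<sigma>) * norm b * \<delta>) + 0 + A * I)) ?A"
      unfolding g1_def v_def using d ep
      by (intro has_integral_diff has_integral_add has_integral_mult_right ann_const
          has_integral_annulus_odd I) auto
    have sub: "f integrable_on ?D" if "f integrable_on halfspace e" "\<And>y. y \<in> halfspace e \<Longrightarrow> 0 \<le> f y" for f :: "'a \<Rightarrow> real"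
    proof -
      have "f absolutely_integrable_on halfspace e"
        using that by (intro nonnegative_absolutely_integrable_1) auto
      hence "f absolutely_integrable_on ?D"
        by (rule set_integrable_subset) (auto intro!: sets_completionI_sets)
      thus ?thesis by (rule set_lebesgue_integral_eq_integral(1))
    qed
    have uD: "As_weight s e u integrable_on ?D"
      using ui wt_nonneg by (intro sub) (auto simp: As_weight_eq)
    have wD: "wt integrable_on ?D"
      using wt_nonneg by (intro sub wt_integrable)
    define JD where "JD = integral ?D (As_weight s e u)"
    define WD where "WD = integral ?D wt"
    have WD: "WD \<le> W" unfolding WD_def W_def using wt_nonneg wD
      by (intro integral_subset_le wt_integrable) auto
    have gI: "(g has_integral (v * (k * U + (k + \<sigma>) * norm b * \<delta>) + 0 + A * I + C1 * T * U * WD - k * JD)) ?D"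
      unfolding g_def
    proof (intro has_integral_diff has_integral_add)
      show "((\<lambda>y. if y \<in> ?A then g1 y else 0) has_integral (v * (k * U + (k + \<sigma>) * norm b * \<delta>) + 0 + A * I)) ?D"
        using g1 by (subst has_integral_restrict[OF AD])
      show "((\<lambda>y. k * As_weight s e u y) has_integral k * JD) ?D"
        unfolding JD_def by (intro has_integral_mult_right integrable_integral uD)
      show "((\<lambda>y. C1 * T * U * wt y) has_integral C1 * T * U * WD) ?D"
        unfolding WD_def by (intro has_integral_mult_right integrable_integral wD)
    qed
    have main: "integral ?D (frac_kernel_integrand s e u x) \<le> v * (k * U + (k + \<sigma>) * norm b * \<delta>) + A * I + C1 * T * U * WD - k * JD"
      using has_integral_le[OF integrable_integral[OF fi] gI le] by simp
    have "\<delta> ^ DIM('a) \<le> 1" using d d1 by (intro power_le_one) auto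
    moreover have "0 \<le> \<epsilon> ^ DIM('a)" using ep by simp
    ultimately have "\<delta> ^ DIM('a) - \<epsilon> ^ DIM('a) \<le> 1" by linarith
    hence v2: "v \<le> vol1" unfolding v_def using vol1_pos mult_left_mono[of "\<delta> ^ DIM('a) - \<epsilon> ^ DIM('a)" 1 vol1] by simp
    have nb: "norm b * \<delta> \<le> norm b" using d1 d by (intro mult_left_le) auto
    hence "(k + \<sigma>) * (norm b * \<delta>) \<le> (k + \<sigma>) * norm b" using k sig by (intro mult_left_mono) auto
    hence nb': "k * U + (k + \<sigma>) * norm b * \<delta> \<le> k * U + (k + \<sigma>) * norm b" by (simp add: mult.assoc)
    have "v * (k * U + (k + \<sigma>) * norm b * \<delta>) \<le> vol1 * (k * U + (k + \<sigma>) * norm b * \<delta>)"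
      using v2 k U0 sig d by (intro mult_right_mono) auto
    also have "\<dots> \<le> vol1 * (k * U + (k + \<sigma>) * norm b)" using nb' vol1_pos by (intro mult_left_mono) auto
    finally have t1: "v * (k * U + (k + \<sigma>) * norm b * \<delta>) \<le> vol1 * k * U + Cb * norm b"
      by (simp add: Cb_def algebra_simps)
    have "\<delta> powr (2 - 2 * s) \<le> 1 powr (2 - 2 * s)" using d d1 s by (intro powr_mono2) auto
    hence "C0 * \<delta> powr (2 - 2 * s) \<le> C0 * 1" using C0 by (intro mult_left_mono) auto
    hence "I \<le> C0" using I by simp
    hence t3: "A * I \<le> A * C0" using A by (rule mult_left_mono)
    have t4: "C1 * T * U * WD \<le> C1 * T * U * W" using C1 T0 U0 WD by (intro mult_left_mono) auto
    have "Ca * U + Cb * norm b + C0 * A \<le> C * U + C * norm b + C * A"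
      using Ca Cb C0 U0 A by (intro add_mono mult_right_mono) (auto simp: C_def)
    thus ?thesis using main t1 t3 t4 unfolding U_def[symmetric] JD_def[symmetric]
      by (simp add: Ca_def algebra_simps)
  qed
  thus ?thesis using Cp k
    by (intro exI[of _ k] conjI exI[of _ C]) auto
qed

section \<open>The local part of the principal value for Hoelder functions\<close>

text \<open>An exponent \<open>\<beta>\<close> above \<open>2 * s\<close> makes the Taylor remainder
  integrable against the kernel, and the linear part cancels up to the reflected term. The bound
  vanishes with \<open>\<delta>\<close>, uniformly in \<open>\<epsilon>\<close>. Its dependence on
  the regularity of \<open>u\<close> is harmless, because it serves only to prove continuity of the
  principal value.\<close>

lemma local_part_bound:
  assumes beta: "2 * s < \<beta>"
  shows "\<exists>C>0. \<forall>x\<in>ball e \<rho>. \<forall>u G B \<delta> \<epsilon>.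
    0 < \<epsilon> \<longrightarrow> \<epsilon> \<le> \<delta> \<longrightarrow> 2 * \<delta> \<le> 1 - \<rho> \<longrightarrow> 0 \<le> B \<longrightarrow>
    (\<forall>y\<in>cball x \<delta>. \<bar>u x - u y - G \<bullet> (y - x)\<bar> \<le> B * norm (y - x) powr \<beta>) \<longrightarrow>
    frac_kernel_integrand s e u x integrable_on (ann x \<delta> \<epsilon>) \<longrightarrow>
    \<bar>integral (ann x \<delta> \<epsilon>) (frac_kernel_integrand s e u x)\<bar> \<le> C * (B * \<delta> powr (\<beta> - 2 * s) + norm G * \<delta>)"
proof -
  obtain C0 where C0: "0 < C0" and C0': "\<And>x d \<epsilon>. 0 < d \<Longrightarrow> 0 < \<epsilon> \<Longrightarrow>
    (\<exists>I. ((\<lambda>y::'a. norm (x - y) powr ((\<beta> - 2 * s) - real DIM('a))) has_integral I) (ann x d \<epsilon>) \<and> I \<le> C0 * d powr (\<beta> - 2 * s))"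
    using ann_powr[of "\<beta> - 2 * s"] beta by auto
  define \<sigma> where "\<sigma> = (1 - \<rho>) powr (- q)"
  have sig: "0 \<le> \<sigma>" by (simp add: \<sigma>_def)
  define C where "C = C0 + \<sigma> * vol1"
  have sv: "0 \<le> \<sigma> * vol1" using sig vol1_pos by simp
  have Cp: "0 < C" using C0 sv by (simp add: C_def)
  have "\<bar>integral (ann x \<delta> \<epsilon>) (frac_kernel_integrand s e u x)\<bar> \<le> C * (B * \<delta> powr (\<beta> - 2 * s) + norm G * \<delta>)"
    if x: "x \<in> ball e \<rho>" and ep: "0 < \<epsilon>" "\<epsilon> \<le> \<delta>" and d: "2 * \<delta> \<le> 1 - \<rho>" and B: "0 \<le> B"
      and tay: "\<forall>y\<in>cball x \<delta>. \<bar>u x - u y - G \<bullet> (y - x)\<bar> \<le> B * norm (y - x) powr \<beta>"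
      and fi: "frac_kernel_integrand s e u x integrable_on (ann x \<delta> \<epsilon>)" for x u G B \<delta> \<epsilon>
  proof -
    let ?A = "ann x \<delta> \<epsilon>"
    have d0: "0 < \<delta>" using ep by simp
    have d1: "\<delta> \<le> 1" using d rho by simp
    define h where "h = (\<lambda>y. norm (x - y) powr (- q) * (G \<bullet> (y - x)))"
    define g where "g = (\<lambda>y. B * norm (x - y) powr ((\<beta> - 2 * s) - real DIM('a)) + \<sigma> * norm G * \<delta>)"
    have hi: "(h has_integral 0) ?A" unfolding h_def using ep by (intro has_integral_annulus_odd) auto
    obtain I where I: "((\<lambda>y::'a. norm (x - y) powr ((\<beta> - 2 * s) - real DIM('a))) has_integral I) ?A" "I \<le> C0 * \<delta> powr (\<beta> - 2 * s)"
      using C0'[OF d0 ep(1)] by blast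
    define v where "v = vol1 * (\<delta> ^ DIM('a) - \<epsilon> ^ DIM('a))"
    have gi: "(g has_integral (B * I + v * (\<sigma> * norm G * \<delta>))) ?A"
      unfolding g_def v_def using ep by (intro has_integral_add has_integral_mult_right I ann_const)
    have pt: "\<bar>frac_kernel_integrand s e u x y - h y\<bar> \<le> g y" if y: "y \<in> ?A" for y
    proof -
      have yb: "y \<in> cball x \<delta>" "y \<noteq> x" using y ep by auto
      note cs = cball_subset[OF x d yb(1)]
      have kn: "0 \<le> kern x y" using kern_nonneg[OF ball_e(4)[OF x] cs(2) yb(2)] .
      have "frac_kernel_integrand s e u x y - h y = kern x y * (u x - u y - G \<bullet> (y - x))
          + (kern x y * (G \<bullet> (y - x)) - norm (x - y) powr (- q) * (G \<bullet> (y - x)))"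
        by (simp add: frac_eq h_def algebra_simps)
      hence "\<bar>frac_kernel_integrand s e u x y - h y\<bar> \<le> \<bar>kern x y * (u x - u y - G \<bullet> (y - x))\<bar>
          + \<bar>kern x y * (G \<bullet> (y - x)) - norm (x - y) powr (- q) * (G \<bullet> (y - x))\<bar>" by linarith
      also have "\<dots> \<le> kern x y * \<bar>u x - u y - G \<bullet> (y - x)\<bar> + \<sigma> * norm G * \<delta>"
        using kern_affine[OF x d yb(1), of G] kn by (simp add: abs_mult \<sigma>_def)
      also have "\<dots> \<le> norm (x - y) powr (- q) * (B * norm (y - x) powr \<beta>) + \<sigma> * norm G * \<delta>"
        using tay yb kn kern_le_powr[of x y] by (intro add_right_mono mult_mono) auto
      also have "norm (x - y) powr (- q) * (B * norm (y - x) powr \<beta>) = B * norm (x - y) powr ((\<beta> - 2 * s) - real DIM('a))"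
      proof -
        have "norm (x - y) powr (- q) * norm (x - y) powr \<beta> = norm (x - y) powr ((\<beta> - 2 * s) - real DIM('a))"
          unfolding powr_add[symmetric] by (rule arg_cong[where f="\<lambda>t. _ powr t"]) (simp add: q_def)
        thus ?thesis by (simp add: norm_minus_commute[of y] mult_ac)
      qed
      finally show ?thesis by (simp add: g_def)
    qed
    have di: "((\<lambda>y. frac_kernel_integrand s e u x y - h y) has_integral (integral ?A (frac_kernel_integrand s e u x) - 0)) ?A"
      by (intro has_integral_diff integrable_integral fi hi)
    have "integral ?A (frac_kernel_integrand s e u x) - 0 \<le> B * I + v * (\<sigma> * norm G * \<delta>)"
      by (rule has_integral_le[OF di gi]) (use pt in \<open>force simp: abs_le_iff\<close>)
    moreover have "- (integral ?A (frac_kernel_integrand s e u x) - 0) \<le> B * I + v * (\<sigma> * norm G * \<delta>)"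
      by (rule has_integral_le[OF has_integral_neg[OF di] gi]) (use pt in \<open>force simp: abs_le_iff\<close>)
    ultimately have main: "\<bar>integral ?A (frac_kernel_integrand s e u x)\<bar> \<le> B * I + v * (\<sigma> * norm G * \<delta>)" by linarith
    have "\<delta> ^ DIM('a) \<le> 1" using d0 d1 by (intro power_le_one) auto
    moreover have "0 \<le> \<epsilon> ^ DIM('a)" using ep by simp
    ultimately have "\<delta> ^ DIM('a) - \<epsilon> ^ DIM('a) \<le> 1" by linarith
    hence v2: "v \<le> vol1" unfolding v_def using vol1_pos mult_left_mono[of "\<delta> ^ DIM('a) - \<epsilon> ^ DIM('a)" 1 vol1] by simp
    have "v * (\<sigma> * norm G * \<delta>) \<le> vol1 * (\<sigma> * norm G * \<delta>)" using v2 sig d0 by (intro mult_right_mono) auto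
    also have "\<dots> = (\<sigma> * vol1) * (norm G * \<delta>)" by simp
    also have "\<dots> \<le> C * (norm G * \<delta>)" using C0 d0 by (intro mult_right_mono) (auto simp: C_def)
    finally have t2: "v * (\<sigma> * norm G * \<delta>) \<le> C * (norm G * \<delta>)" .
    have "B * I \<le> B * (C0 * \<delta> powr (\<beta> - 2 * s))" using I B by (intro mult_left_mono) auto
    also have "\<dots> \<le> B * (C * \<delta> powr (\<beta> - 2 * s))" using B sv
      by (intro mult_left_mono mult_right_mono) (auto simp: C_def)
    finally show ?thesis using main t2 by (simp add: algebra_simps)
  qed
  thus ?thesis using Cp by (intro exI[of _ C] conjI) auto
qed


section \<open>Continuity of the fractional Laplacian\<close>

lemma hoelder_bounds:
  assumes "hoelder (2 * s + \<alpha>) (ball e \<rho>) u" "0 < \<alpha>"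
  shows "continuous_on (ball e \<rho>) u" "bounded (u ` ball e \<rho>)"
proof -
  obtain D :: "'a list \<Rightarrow> 'a \<Rightarrow> real" where D: "\<And>x. x \<in> ball e \<rho> \<Longrightarrow> D [] x = u x"
    and c: "continuous_on (ball e \<rho>) (D [])" "bounded (D [] ` ball e \<rho>)"
  proof -
    define k where "k = nat \<lfloor>2 * s + \<alpha>\<rfloor>"
    define \<gamma> where "\<gamma> = 2 * s + \<alpha> - of_int \<lfloor>2 * s + \<alpha>\<rfloor>"
    obtain D where d: "\<forall>x\<in>ball e \<rho>. D [] x = u x"
      "\<forall>ds. set ds \<subseteq> Basis \<and> length ds < k \<longrightarrow>
        (\<forall>x\<in>ball e \<rho>. (D ds has_derivative (\<lambda>h. \<Sum>b\<in>Basis. (h \<bullet> b) * D (b # ds) x)) (at x))"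
      "\<forall>ds. set ds \<subseteq> Basis \<and> length ds \<le> k \<longrightarrow> continuous_on (ball e \<rho>) (D ds) \<and> bounded (D ds ` ball e \<rho>)"
      "\<forall>ds. set ds \<subseteq> Basis \<and> length ds = k \<longrightarrow>
        (\<exists>H. \<forall>x\<in>ball e \<rho>. \<forall>y\<in>ball e \<rho>. \<bar>D ds x - D ds y\<bar> \<le> H * dist x y powr \<gamma>)"
      using assms(1) unfolding hoelder_def hoelder_kg_def k_def[symmetric] \<gamma>_def[symmetric] by (elim exE conjE)
    have "continuous_on (ball e \<rho>) (D []) \<and> bounded (D [] ` ball e \<rho>)"
      using spec[OF d(3), of "[]"] by simp
    thus ?thesis using d(1) that by blast
  qed
  show "continuous_on (ball e \<rho>) u" by (rule continuous_on_eq[OF c(1)]) (rule D)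
  have "D [] ` ball e \<rho> = u ` ball e \<rho>" by (rule image_cong[OF refl D])
  thus "bounded (u ` ball e \<rho>)" using c(2) by argo
qed

lemma sum_inner_Basis: "(\<Sum>b\<in>Basis. (h \<bullet> b) * f b) = (\<Sum>b\<in>Basis. f b *\<^sub>R b) \<bullet> (h::'a)"
  by (simp add: inner_sum_left inner_commute[of h] mult.commute)

lemma onorm_coords_le:
  assumes "\<And>b. b \<in> Basis \<Longrightarrow> \<bar>f b\<bar> \<le> B"
  shows "onorm (\<lambda>h::'a. \<Sum>b\<in>Basis. (h \<bullet> b) * f b) \<le> real DIM('a) * B"
proof (rule onorm_le)
  fix h :: 'a
  have "norm (\<Sum>b\<in>Basis. (h \<bullet> b) * f b) \<le> (\<Sum>b\<in>(Basis::'a set). norm h * B)"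
  proof (rule sum_norm_le)
    fix b :: 'a assume b: "b \<in> Basis"
    show "norm ((h \<bullet> b) * f b) \<le> norm h * B"
      using Basis_le_norm[OF b, of h] assms[OF b] by (auto simp: abs_mult intro!: mult_mono)
  qed
  thus "norm (\<Sum>b\<in>Basis. (h \<bullet> b) * f b) \<le> real DIM('a) * B * norm h" by (simp add: mult_ac)
qed

text \<open>Within distance \<open>norm (y - x)\<close> of \<open>x\<close> the gradient deviates
  from its value at \<open>x\<close> by at most \<open>H * norm (y - x) powr \<gamma>\<close> in
  each coordinate, and the mean value inequality turns this into a first-order remainder. The
  gradient carries a minus sign because the increment is the value at \<open>x\<close> minus the
  value at \<open>y\<close>.\<close>

lemma taylor_from_hoelder_gradient:
  fixes D :: "'a list \<Rightarrow> 'a \<Rightarrow> real"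
  assumes der: "\<And>x. x \<in> ball e \<rho> \<Longrightarrow> (D [] has_derivative (\<lambda>h. \<Sum>b\<in>Basis. (h \<bullet> b) * D [b] x)) (at x)"
    and H: "\<And>b x y. b \<in> Basis \<Longrightarrow> x \<in> ball e \<rho> \<Longrightarrow> y \<in> ball e \<rho> \<Longrightarrow> \<bar>D [b] x - D [b] y\<bar> \<le> H * dist x y powr \<gamma>"
    and H0: "0 \<le> H" and g0: "0 \<le> \<gamma>" and x: "x \<in> ball e \<rho>" and y: "y \<in> ball e \<rho>"
  shows "\<bar>D [] x - D [] y - (- (\<Sum>b\<in>Basis. D [b] x *\<^sub>R b)) \<bullet> (y - x)\<bar> \<le> (real DIM('a) * H) * norm (y - x) powr (1 + \<gamma>)"
proof (cases "y = x")
  case False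
  define r where "r = norm (y - x)"
  have r: "0 < r" using False by (simp add: r_def)
  let ?S = "ball e \<rho> \<inter> cball x r"
  have "norm (D [] y - D [] x - (\<Sum>b\<in>Basis. ((y - x) \<bullet> b) * D [b] x)) \<le> norm (y - x) * (real DIM('a) * (H * r powr \<gamma>))"
  proof (rule differentiable_bound_linearization[where S = ?S and f' = "\<lambda>x h. \<Sum>b\<in>Basis. (h \<bullet> b) * D [b] x"])
    fix t :: real assume t: "t \<in> {0..1}"
    have cv: "convex ?S" by (intro convex_Int) auto
    have "x \<in> ?S" "y \<in> ?S" using x y r by (auto simp: r_def dist_norm norm_minus_commute)
    hence "(1 - t) *\<^sub>R x + t *\<^sub>R y \<in> ?S" using t by (intro convexD[OF cv]) auto
    thus "x + t *\<^sub>R (y - x) \<in> ?S" by (simp add: algebra_simps)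
  next
    fix z assume z: "z \<in> ?S"
    thus "(D [] has_derivative (\<lambda>h. \<Sum>b\<in>Basis. (h \<bullet> b) * D [b] z)) (at z within ?S)"
      using der by (auto intro: has_derivative_at_withinI)
    have "onorm (\<lambda>h::'a. \<Sum>b\<in>Basis. (h \<bullet> b) * (D [b] z - D [b] x)) \<le> real DIM('a) * (H * r powr \<gamma>)"
    proof (rule onorm_coords_le)
      fix b :: 'a assume b: "b \<in> Basis"
      have "\<bar>D [b] z - D [b] x\<bar> \<le> H * dist z x powr \<gamma>" using H[OF b] z x by auto
      also have "\<dots> \<le> H * r powr \<gamma>" using z H0 g0
        by (intro mult_left_mono powr_mono2) (auto simp: dist_commute)
      finally show "\<bar>D [b] z - D [b] x\<bar> \<le> H * r powr \<gamma>" .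
    qed
    moreover have "(\<lambda>h. \<Sum>b\<in>Basis. (h \<bullet> b) * (D [b] z - D [b] x))
       = (\<lambda>h. \<Sum>b\<in>Basis. (h \<bullet> b) * D [b] z) - (\<lambda>h. \<Sum>b\<in>Basis. (h \<bullet> b) * D [b] x)"
      by (auto simp: fun_eq_iff algebra_simps sum_subtractf)
    ultimately show "onorm ((\<lambda>h. \<Sum>b\<in>Basis. (h \<bullet> b) * D [b] z) - (\<lambda>h. \<Sum>b\<in>Basis. (h \<bullet> b) * D [b] x))
        \<le> real DIM('a) * (H * r powr \<gamma>)" by simp
  next
    show "x \<in> ?S" using x r by auto
  qed
  also have "norm (y - x) * (real DIM('a) * (H * r powr \<gamma>)) = (real DIM('a) * H) * norm (y - x) powr (1 + \<gamma>)"
    using r by (simp add: r_def powr_add mult_ac)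
  finally have "\<bar>D [] y - D [] x - (\<Sum>b\<in>Basis. D [b] x *\<^sub>R b) \<bullet> (y - x)\<bar> \<le> (real DIM('a) * H) * norm (y - x) powr (1 + \<gamma>)"
    unfolding sum_inner_Basis by simp
  thus ?thesis by (simp add: abs_minus_commute algebra_simps)
qed simp

text \<open>A first-order expansion exploits at most two orders of smoothness. So
  \<open>\<beta>\<close> is \<open>\<gamma>\<close> with zero gradient for \<open>k = 0\<close>,
  \<open>1 + \<gamma>\<close> for \<open>k = 1\<close>, and 2 for larger \<open>k\<close>, where
  bounded second derivatives make the gradient Lipschitz; the last value exceeds
  \<open>2 * s\<close> because \<open>s < 1\<close>.\<close>

lemma hoelder_taylor:
  assumes h: "hoelder (2 * s + \<alpha>) (ball e \<rho>) u" and al: "0 < \<alpha>"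
  shows "\<exists>\<beta> G H B. 2 * s < \<beta> \<and> 0 \<le> H \<and> (\<forall>x\<in>ball e \<rho>. norm (G x) \<le> B) \<and>
    (\<forall>x\<in>ball e \<rho>. \<forall>y\<in>ball e \<rho>. \<bar>u x - u y - G x \<bullet> (y - x)\<bar> \<le> H * norm (y - x) powr \<beta>)"
proof -
  define k where "k = nat \<lfloor>2 * s + \<alpha>\<rfloor>"
  define \<gamma> where "\<gamma> = 2 * s + \<alpha> - of_int \<lfloor>2 * s + \<alpha>\<rfloor>"
  have pos: "0 < 2 * s + \<alpha>" using s al by simp
  hence kg: "real k + \<gamma> = 2 * s + \<alpha>" by (simp add: k_def \<gamma>_def)
  have g0: "0 \<le> \<gamma>" by (simp add: \<gamma>_def)
  let ?W = "ball e \<rho>"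
  obtain D where D: "\<forall>x\<in>?W. D [] x = u x"
    and der: "\<And>ds x. set ds \<subseteq> Basis \<Longrightarrow> length ds < k \<Longrightarrow> x \<in> ?W \<Longrightarrow>
        (D ds has_derivative (\<lambda>h. \<Sum>b\<in>Basis. (h \<bullet> b) * D (b # ds) x)) (at x)"
    and bd: "\<And>ds. set ds \<subseteq> Basis \<Longrightarrow> length ds \<le> k \<Longrightarrow> bounded (D ds ` ?W)"
    and ho: "\<And>ds. set ds \<subseteq> Basis \<Longrightarrow> length ds = k \<Longrightarrow>
        \<exists>H. \<forall>x\<in>?W. \<forall>y\<in>?W. \<bar>D ds x - D ds y\<bar> \<le> H * dist x y powr \<gamma>"
  proof -
    obtain D where "\<forall>x\<in>?W. D [] x = u x"
      "\<forall>ds. set ds \<subseteq> Basis \<and> length ds < k \<longrightarrow>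
        (\<forall>x\<in>?W. (D ds has_derivative (\<lambda>h. \<Sum>b\<in>Basis. (h \<bullet> b) * D (b # ds) x)) (at x))"
      "\<forall>ds. set ds \<subseteq> Basis \<and> length ds \<le> k \<longrightarrow> continuous_on ?W (D ds) \<and> bounded (D ds ` ?W)"
      "\<forall>ds. set ds \<subseteq> Basis \<and> length ds = k \<longrightarrow>
        (\<exists>H. \<forall>x\<in>?W. \<forall>y\<in>?W. \<bar>D ds x - D ds y\<bar> \<le> H * dist x y powr \<gamma>)"
      using h unfolding hoelder_def hoelder_kg_def k_def[symmetric] \<gamma>_def[symmetric] by (elim exE conjE)
    thus ?thesis by (intro that[of D]) auto
  qed
  show ?thesis
  proof (cases "k = 0")
    case True
    obtain H where H: "\<forall>x\<in>?W. \<forall>y\<in>?W. \<bar>D [] x - D [] y\<bar> \<le> H * dist x y powr \<gamma>"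
      using ho[of "[]"] True by auto
    have "\<bar>u x - u y - 0 \<bullet> (y - x)\<bar> \<le> \<bar>H\<bar> * norm (y - x) powr \<gamma>" if "x \<in> ?W" "y \<in> ?W" for x y
    proof -
      have "\<bar>u x - u y\<bar> \<le> H * dist x y powr \<gamma>" using H D that by metis
      also have "\<dots> \<le> \<bar>H\<bar> * dist x y powr \<gamma>" by (intro mult_right_mono) auto
      finally show ?thesis by (simp add: dist_norm norm_minus_commute)
    qed
    moreover have "2 * s < \<gamma>" using kg True al by simp
    ultimately show ?thesis
      by (intro exI[of _ \<gamma>] exI[of _ "\<lambda>_. 0"] exI[of _ "\<bar>H\<bar>"] exI[of _ 0]) auto
  next
    case False
    have "\<forall>b\<in>Basis. \<exists>B. \<forall>x\<in>?W. \<bar>D [b] x\<bar> \<le> B"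
      proof
      fix b :: 'a assume "b \<in> Basis"
      hence "bounded (D [b] ` ?W)" using bd[of "[b]"] False by simp
      thus "\<exists>B. \<forall>x\<in>?W. \<bar>D [b] x\<bar> \<le> B" by (auto simp: bounded_iff)
    qed
    then obtain B0 where B0: "\<And>b x. b \<in> Basis \<Longrightarrow> x \<in> ?W \<Longrightarrow> \<bar>D [b] x\<bar> \<le> B0 b" by metis
    have G: "norm (- (\<Sum>b\<in>Basis. D [b] x *\<^sub>R b)) \<le> (\<Sum>b\<in>Basis. B0 b)" if "x \<in> ?W" for x
      unfolding norm_minus_cancel by (rule sum_norm_le) (use B0 that in auto)
    have der0: "\<And>x. x \<in> ?W \<Longrightarrow> (D [] has_derivative (\<lambda>h. \<Sum>b\<in>Basis. (h \<bullet> b) * D [b] x)) (at x)"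
      using der[of "[]"] False by auto
    have "\<exists>\<gamma>' H. 2 * s < 1 + \<gamma>' \<and> 0 \<le> \<gamma>' \<and> 0 \<le> H \<and>
      (\<forall>b\<in>Basis. \<forall>x\<in>?W. \<forall>y\<in>?W. \<bar>D [b] x - D [b] y\<bar> \<le> H * dist x y powr \<gamma>')"
    proof (cases "k = 1")
      case True
      have "\<forall>b\<in>Basis. \<exists>H. \<forall>x\<in>?W. \<forall>y\<in>?W. \<bar>D [b] x - D [b] y\<bar> \<le> H * dist x y powr \<gamma>"
        proof
        fix b :: 'a assume "b \<in> Basis"
        thus "\<exists>H. \<forall>x\<in>?W. \<forall>y\<in>?W. \<bar>D [b] x - D [b] y\<bar> \<le> H * dist x y powr \<gamma>"
          using ho[of "[b]"] True by simp
      qed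
      then obtain H where H: "\<And>b x y. b \<in> Basis \<Longrightarrow> x \<in> ?W \<Longrightarrow> y \<in> ?W \<Longrightarrow> \<bar>D [b] x - D [b] y\<bar> \<le> H b * dist x y powr \<gamma>"
        by metis
      have "\<bar>D [b] x - D [b] y\<bar> \<le> (\<Sum>b\<in>Basis. \<bar>H b\<bar>) * dist x y powr \<gamma>"
        if "b \<in> Basis" "x \<in> ?W" "y \<in> ?W" for b x y
      proof -
        have "H b \<le> \<bar>H b\<bar>" by simp
        also have "\<dots> \<le> (\<Sum>b\<in>Basis. \<bar>H b\<bar>)" using that by (intro member_le_sum) auto
        finally have "H b * dist x y powr \<gamma> \<le> (\<Sum>b\<in>Basis. \<bar>H b\<bar>) * dist x y powr \<gamma>" by (intro mult_right_mono) auto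
        thus ?thesis using H[OF that] by linarith
      qed
      moreover have "2 * s < 1 + \<gamma>" using kg True al by simp
      ultimately show ?thesis using g0
        by (intro exI[of _ \<gamma>] exI[of _ "\<Sum>b\<in>Basis. \<bar>H b\<bar>"]) (auto intro: sum_nonneg)
    next
      case k1: False
      have "\<forall>b\<in>Basis. \<forall>b'\<in>Basis. \<exists>B. \<forall>x\<in>?W. \<bar>D [b', b] x\<bar> \<le> B"
        proof (intro ballI)
        fix b b' :: 'a assume "b \<in> Basis" "b' \<in> Basis"
        hence "bounded (D [b', b] ` ?W)" using bd[of "[b', b]"] False k1 by simp
        thus "\<exists>B. \<forall>x\<in>?W. \<bar>D [b', b] x\<bar> \<le> B" by (auto simp: bounded_iff)
      qed
      then obtain B1 where B1: "\<And>b b' x. b \<in> Basis \<Longrightarrow> b' \<in> Basis \<Longrightarrow> x \<in> ?W \<Longrightarrow> \<bar>D [b', b] x\<bar> \<le> B1 b b'" by metis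
      define L where "L = (\<Sum>b\<in>Basis. \<Sum>b'\<in>Basis. \<bar>B1 b b'\<bar>)"
      have L0: "0 \<le> L" by (simp add: L_def sum_nonneg)
      have B1L: "\<bar>D [b', b] x\<bar> \<le> L" if "b \<in> Basis" "b' \<in> Basis" "x \<in> ?W" for b b' x
      proof -
        have "\<bar>D [b', b] x\<bar> \<le> \<bar>B1 b b'\<bar>" using B1[OF that] by simp
        also have "\<dots> \<le> (\<Sum>b'\<in>Basis. \<bar>B1 b b'\<bar>)" using that by (intro member_le_sum) auto
        also have "\<dots> \<le> L" unfolding L_def using that
          by (intro member_le_sum[of b Basis "\<lambda>b. \<Sum>b'\<in>Basis. \<bar>B1 b b'\<bar>"]) (auto intro: sum_nonneg)
        finally show ?thesis .
      qed
      have "\<bar>D [b] x - D [b] y\<bar> \<le> (real DIM('a) * L) * dist x y powr 1" if b: "b \<in> Basis" and xy: "x \<in> ?W" "y \<in> ?W" for b x y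
      proof -
        have "norm (D [b] x - D [b] y) \<le> (real DIM('a) * L) * norm (x - y)"
        proof (rule differentiable_bound[OF convex_ball])
          fix z assume z: "z \<in> ?W"
          show "(D [b] has_derivative (\<lambda>h. \<Sum>b'\<in>Basis. (h \<bullet> b') * D [b', b] z)) (at z within ?W)"
            using der[of "[b]" z] b z False k1 by (auto intro: has_derivative_at_withinI)
          show "onorm (\<lambda>h. \<Sum>b'\<in>Basis. (h \<bullet> b') * D [b', b] z) \<le> real DIM('a) * L"
            using B1L b z by (intro onorm_coords_le) auto
        qed (use xy in auto)
        thus ?thesis by (simp add: dist_norm)
      qed
      thus ?thesis using s L0
        by (intro exI[of _ 1] exI[of _ "real DIM('a) * L"]) auto
    qed
    then obtain \<gamma>' H where g': "2 * s < 1 + \<gamma>'" "0 \<le> \<gamma>'" "0 \<le> H"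
      and H: "\<And>b x y. b \<in> Basis \<Longrightarrow> x \<in> ?W \<Longrightarrow> y \<in> ?W \<Longrightarrow> \<bar>D [b] x - D [b] y\<bar> \<le> H * dist x y powr \<gamma>'" by blast
    have "\<bar>u x - u y - (- (\<Sum>b\<in>Basis. D [b] x *\<^sub>R b)) \<bullet> (y - x)\<bar> \<le> (real DIM('a) * H) * norm (y - x) powr (1 + \<gamma>')"
      if "x \<in> ?W" "y \<in> ?W" for x y
      using taylor_from_hoelder_gradient[OF der0 H g'(3) g'(2) that] D that by simp
    thus ?thesis using g' G
      by (intro exI[of _ "1 + \<gamma>'"] exI[of _ "\<lambda>x. - (\<Sum>b\<in>Basis. D [b] x *\<^sub>R b)"]
          exI[of _ "real DIM('a) * H"] exI[of _ "\<Sum>b\<in>Basis. B0 b"]) auto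
  qed
qed

section \<open>Truncated integrals and the principal value as the base point moves\<close>

lemma tendsto_kern:
  assumes "(X \<longlongrightarrow> x) F" "x \<in> halfspace e" "y \<in> halfspace e" "y \<noteq> x"
  shows "((\<lambda>j. kern (X j) y) \<longlongrightarrow> kern x y) F"
proof -
  have "norm (refl_e e x - y) \<noteq> 0" using norm_lt_refl[OF assms(2,3)] norm_ge_zero[of "x - y"] by linarith
  thus ?thesis unfolding kern_def refl_e_def using assms
    by (intro tendsto_intros) (auto simp: refl_e_def)
qed



text \<open>The domain of integration moves with \<open>X j\<close>, so it is encoded by a cut-off
  on a fixed set before dominated convergence is applied. By \<open>kern_upper\<close> a combination
  of \<open>wt\<close> and \<open>As_weight s e u\<close> dominates.\<close>

lemma truncated_integral_tendsto:
  assumes X: "X \<longlonglongrightarrow> x" and Xb: "\<And>j. X j \<in> ball e \<rho>" and x: "x \<in> ball e \<rho>" and d: "0 < \<delta>" "\<delta> \<le> 1"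
    and uX: "(\<lambda>j. u (X j)) \<longlonglongrightarrow> u x" and ui: "As_weight s e u integrable_on halfspace e"
    and fi: "\<And>z. z \<in> ball e \<rho> \<Longrightarrow> frac_kernel_integrand s e u z absolutely_integrable_on (halfspace e - ball z \<delta>)"
  shows "(\<lambda>j. integral (halfspace e - cball (X j) \<delta>) (frac_kernel_integrand s e u (X j)))
     \<longlonglongrightarrow> integral (halfspace e - cball x \<delta>) (frac_kernel_integrand s e u x)"
proof -
  \<comment> \<open>On this sphere the cut-offs at \<open>X j\<close> need not converge; it is
    removed as a null set.\<close>
  let ?S = "halfspace e - sphere x \<delta>"
  obtain C1 where C1: "0 < C1" and C1': "\<And>x y \<delta>. x \<in> ball e \<rho> \<Longrightarrow> y \<in> halfspace e \<Longrightarrow> 0 < \<delta> \<Longrightarrow> \<delta> \<le> 1 \<Longrightarrow>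
      \<delta> \<le> norm (x - y) \<Longrightarrow> kern x y \<le> C1 * \<delta> powr (- q - 2) * wt y"
    using kern_upper by blast
  obtain B where B: "\<And>j. \<bar>u (X j)\<bar> \<le> B"
    using convergent_imp_Bseq[of "\<lambda>j. u (X j)"] uX by (auto simp: convergent_def Bseq_def)
  define F where "F = (\<lambda>z y. if y \<in> - cball z \<delta> then frac_kernel_integrand s e u z y else 0)"
  have F: "integral ?S (F z) = integral (halfspace e - cball z \<delta>) (frac_kernel_integrand s e u z)"
      "F z integrable_on ?S" if z: "z \<in> ball e \<rho>" for z
  proof -
    have "integral ?S (F z) = integral (- cball z \<delta> \<inter> ?S) (frac_kernel_integrand s e u z)"
      unfolding F_def by (rule integral_restrict_Int)
    also have "\<dots> = integral (halfspace e - cball z \<delta>) (frac_kernel_integrand s e u z)"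
      by (rule integral_spike_set; rule negligible_subset[OF negligible_sphere[of x \<delta>]]) auto
    finally show "integral ?S (F z) = integral (halfspace e - cball z \<delta>) (frac_kernel_integrand s e u z)" .
    have "frac_kernel_integrand s e u z absolutely_integrable_on (- cball z \<delta> \<inter> ?S)"
      by (rule set_integrable_subset[OF fi[OF z]]) (auto intro!: sets_completionI_sets)
    thus "F z integrable_on ?S" unfolding F_def integrable_restrict_Int
      by (rule set_lebesgue_integral_eq_integral(1))
  qed
  have "(\<lambda>j. integral ?S (F (X j))) \<longlonglongrightarrow> integral ?S (F x)"
  proof (rule dominated_convergence(2))
    show "F (X j) integrable_on ?S" for j using F Xb by blast
    define h where "h = (\<lambda>y. C1 * \<delta> powr (- q - 2) * (B * wt y + As_weight s e u y))"
    have "h integrable_on halfspace e" unfolding h_def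
      by (intro integrable_on_mult_right integrable_add wt_integrable ui)
    hence "h absolutely_integrable_on halfspace e"
    proof (rule nonnegative_absolutely_integrable_1)
      fix y assume "y \<in> halfspace e"
      thus "0 \<le> h y" unfolding h_def using C1 B[of 0] wt_nonneg[of y]
        by (intro mult_nonneg_nonneg add_nonneg_nonneg) (auto simp: As_weight_eq)
    qed
    hence "h absolutely_integrable_on ?S"
      by (rule set_integrable_subset) (auto intro!: sets_completionI_sets)
    thus "h integrable_on ?S" by (rule set_lebesgue_integral_eq_integral(1))
    show "norm (F (X j) y) \<le> h y" if y: "y \<in> ?S" for j y
    proof (cases "y \<in> cball (X j) \<delta>")
      case True
      thus ?thesis unfolding F_def h_def using C1 B[of 0] wt_nonneg[of y] y
        by (auto intro!: mult_nonneg_nonneg add_nonneg_nonneg simp: As_weight_eq)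
    next
      case False
      have far: "\<delta> \<le> norm (X j - y)" and yx: "y \<noteq> X j" and yH: "y \<in> halfspace e"
        using False y d by (auto simp: dist_norm)
      have kn: "0 \<le> kern (X j) y" using kern_nonneg[OF ball_e(4)[OF Xb] yH yx] .
      have "norm (F (X j) y) = kern (X j) y * \<bar>u (X j) - u y\<bar>"
        using False kn by (simp add: F_def frac_eq abs_mult)
      also have "\<dots> \<le> (C1 * \<delta> powr (- q - 2) * wt y) * (B + \<bar>u y\<bar>)"
        using C1'[OF Xb yH d far] kn B[of j] by (intro mult_mono) auto
      also have "\<dots> = h y" by (simp add: h_def As_weight_eq algebra_simps)
      finally show ?thesis .
    qed
    show "(\<lambda>j. F (X j) y) \<longlonglongrightarrow> F x y" if y: "y \<in> ?S" for y
    proof (cases "dist x y < \<delta>")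
      case True
      have "(\<lambda>j. dist (X j) y) \<longlonglongrightarrow> dist x y" by (intro tendsto_intros X)
      hence "\<forall>\<^sub>F j in sequentially. dist (X j) y < \<delta>" using True by (rule order_tendstoD)
      hence "\<forall>\<^sub>F j in sequentially. F (X j) y = F x y"
        by eventually_elim (use True in \<open>auto simp: F_def\<close>)
      thus ?thesis by (rule tendsto_eventually)
    next
      case False
      hence dd: "\<delta> < dist x y" using y by auto
      have "(\<lambda>j. dist (X j) y) \<longlonglongrightarrow> dist x y" by (intro tendsto_intros X)
      hence "\<forall>\<^sub>F j in sequentially. \<delta> < dist (X j) y" using dd by (rule order_tendstoD)
      hence ev: "\<forall>\<^sub>F j in sequentially. kern (X j) y * (u (X j) - u y) = F (X j) y"
        by eventually_elim (auto simp: F_def frac_eq)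
      have "(\<lambda>j. kern (X j) y * (u (X j) - u y)) \<longlonglongrightarrow> kern x y * (u x - u y)"
        using y dd d ball_e(4)[OF x] by (intro tendsto_intros tendsto_kern X uX) auto
      also have "kern x y * (u x - u y) = F x y" using dd by (simp add: F_def frac_eq)
      finally show ?thesis using ev by (rule Lim_transform_eventually)
    qed
  qed
  thus ?thesis using F Xb x by simp
qed

text \<open>Truncating at \<open>\<delta>\<close> changes the integral over the complement of the
  \<open>\<epsilon>\<close>-ball by the annulus only, and \<open>local_part_bound\<close> passes to
  the limit in \<open>\<epsilon>\<close>. The result is uniform in \<open>x\<close> because the
  Taylor constants \<open>H\<close> and \<open>B\<close> are.\<close>

lemma truncation_error:
  assumes beta: "2 * s < \<beta>"
    and tay: "\<And>x y. x \<in> ball e \<rho> \<Longrightarrow> y \<in> ball e \<rho> \<Longrightarrow> \<bar>u x - u y - G x \<bullet> (y - x)\<bar> \<le> H * norm (y - x) powr \<beta>"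
    and H: "0 \<le> H" and G: "\<And>x. x \<in> ball e \<rho> \<Longrightarrow> norm (G x) \<le> B"
    and fi: "\<And>x \<epsilon>. x \<in> ball e \<rho> \<Longrightarrow> 0 < \<epsilon> \<Longrightarrow> frac_kernel_integrand s e u x absolutely_integrable_on (halfspace e - ball x \<epsilon>)"
    and lim: "\<And>x. x \<in> ball e \<rho> \<Longrightarrow> ((\<lambda>\<epsilon>. integral (halfspace e - ball x \<epsilon>) (frac_kernel_integrand s e u x)) \<longlongrightarrow> L x) (at_right 0)"
  shows "\<exists>C>0. \<forall>x\<in>ball e \<rho>. \<forall>\<delta>. 0 < \<delta> \<longrightarrow> 2 * \<delta> \<le> 1 - \<rho> \<longrightarrow> cball x \<delta> \<subseteq> ball e \<rho> \<longrightarrow>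
    \<bar>L x - integral (halfspace e - cball x \<delta>) (frac_kernel_integrand s e u x)\<bar> \<le> C * (H * \<delta> powr (\<beta> - 2 * s) + B * \<delta>)"
proof -
  obtain C where C: "0 < C" and C': "\<And>x u G B \<delta> \<epsilon>. x \<in> ball e \<rho> \<Longrightarrow>
    0 < \<epsilon> \<Longrightarrow> \<epsilon> \<le> \<delta> \<Longrightarrow> 2 * \<delta> \<le> 1 - \<rho> \<Longrightarrow> 0 \<le> B \<Longrightarrow>
    (\<forall>y\<in>cball x \<delta>. \<bar>u x - u y - G \<bullet> (y - x)\<bar> \<le> B * norm (y - x) powr \<beta>) \<Longrightarrow>
    frac_kernel_integrand s e u x integrable_on (ann x \<delta> \<epsilon>) \<Longrightarrow>
    \<bar>integral (ann x \<delta> \<epsilon>) (frac_kernel_integrand s e u x)\<bar> \<le> C * (B * \<delta> powr (\<beta> - 2 * s) + norm G * \<delta>)"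
    using local_part_bound[OF beta] by blast
  have "\<bar>L x - integral (halfspace e - cball x \<delta>) (frac_kernel_integrand s e u x)\<bar> \<le> C * (H * \<delta> powr (\<beta> - 2 * s) + B * \<delta>)"
    if x: "x \<in> ball e \<rho>" and d: "0 < \<delta>" "2 * \<delta> \<le> 1 - \<rho>" and sub: "cball x \<delta> \<subseteq> ball e \<rho>" for x \<delta>
  proof -
    let ?f = "frac_kernel_integrand s e u x"
    let ?E = "integral (halfspace e - cball x \<delta>) ?f"
    have lm: "((\<lambda>\<epsilon>. \<bar>integral (halfspace e - ball x \<epsilon>) ?f - ?E\<bar>) \<longlongrightarrow> \<bar>L x - ?E\<bar>) (at_right 0)"
      by (intro tendsto_intros lim x)
    have "\<forall>\<^sub>F \<epsilon> in at_right 0. 0 < \<epsilon> \<and> \<epsilon> < \<delta>"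
      using d by (auto simp: eventually_at_right_field)
    hence "\<forall>\<^sub>F \<epsilon> in at_right 0. \<bar>integral (halfspace e - ball x \<epsilon>) ?f - ?E\<bar> \<le> C * (H * \<delta> powr (\<beta> - 2 * s) + B * \<delta>)"
    proof eventually_elim
      case (elim \<epsilon>)
      have A: "ann x \<delta> \<epsilon> \<subseteq> halfspace e - ball x \<epsilon>" using cball_subset(2)[OF x d(2)] by auto
      have i1: "?f integrable_on (ann x \<delta> \<epsilon>)" using elim
        by (intro set_lebesgue_integral_eq_integral(1) set_integrable_subset[OF fi[OF x] _ A]) (auto intro!: sets_completionI_sets)
      have i2: "?f integrable_on (halfspace e - cball x \<delta>)" using elim
        by (intro set_lebesgue_integral_eq_integral(1) set_integrable_subset[OF fi[OF x, of \<epsilon>]]) (auto intro!: sets_completionI_sets)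
      have "integral ((halfspace e - cball x \<delta>) \<union> ann x \<delta> \<epsilon>) ?f = ?E + integral (ann x \<delta> \<epsilon>) ?f"
        by (intro integral_Un i1 i2) (auto intro: negligible_subset[of "{}"])
      also have "(halfspace e - cball x \<delta>) \<union> ann x \<delta> \<epsilon> = halfspace e - ball x \<epsilon>"
        using A elim by auto
      finally have "\<bar>integral (halfspace e - ball x \<epsilon>) ?f - ?E\<bar> = \<bar>integral (ann x \<delta> \<epsilon>) ?f\<bar>" by simp
      also have "\<dots> \<le> C * (H * \<delta> powr (\<beta> - 2 * s) + norm (G x) * \<delta>)"
        using elim d tay[OF x] sub H i1 by (intro C'[OF x]) auto
      also have "\<dots> \<le> C * (H * \<delta> powr (\<beta> - 2 * s) + B * \<delta>)"
        using C G[OF x] d by (intro mult_left_mono add_left_mono mult_right_mono) auto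
      finally show ?case .
    qed
    thus ?thesis by (intro tendsto_upperbound[OF lm]) auto
  qed
  thus ?thesis using C by (intro exI[of _ C]) auto
qed



text \<open>A locally uniform limit of continuous functions: the truncated integrals depend
  continuously on the base point and approximate the principal value uniformly near
  \<open>x\<close>.\<close>

lemma principal_value_tendsto:
  assumes h: "hoelder (2 * s + \<alpha>) (ball e \<rho>) u" "0 < \<alpha>" and ui: "As_weight s e u integrable_on halfspace e"
    and fi: "\<And>x \<epsilon>. x \<in> ball e \<rho> \<Longrightarrow> 0 < \<epsilon> \<Longrightarrow> frac_kernel_integrand s e u x absolutely_integrable_on (halfspace e - ball x \<epsilon>)"
    and lim: "\<And>x. x \<in> ball e \<rho> \<Longrightarrow> ((\<lambda>\<epsilon>. integral (halfspace e - ball x \<epsilon>) (frac_kernel_integrand s e u x)) \<longlongrightarrow> L x) (at_right 0)"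
    and X: "X \<longlonglongrightarrow> x" and Xb: "\<And>j. X j \<in> ball e \<rho>" and x: "x \<in> ball e \<rho>"
  shows "(\<lambda>j. L (X j)) \<longlonglongrightarrow> L x"
proof -
  obtain \<beta> G H B where beta: "2 * s < \<beta>" and H: "0 \<le> H" and G: "\<And>x. x \<in> ball e \<rho> \<Longrightarrow> norm (G x) \<le> B"
    and tay: "\<And>x y. x \<in> ball e \<rho> \<Longrightarrow> y \<in> ball e \<rho> \<Longrightarrow> \<bar>u x - u y - G x \<bullet> (y - x)\<bar> \<le> H * norm (y - x) powr \<beta>"
    using hoelder_taylor[OF h] by blast
  obtain C where C: "0 < C" and C': "\<And>x \<delta>. x \<in> ball e \<rho> \<Longrightarrow> 0 < \<delta> \<Longrightarrow> 2 * \<delta> \<le> 1 - \<rho> \<Longrightarrow> cball x \<delta> \<subseteq> ball e \<rho> \<Longrightarrow>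
    \<bar>L x - integral (halfspace e - cball x \<delta>) (frac_kernel_integrand s e u x)\<bar> \<le> C * (H * \<delta> powr (\<beta> - 2 * s) + B * \<delta>)"
    using truncation_error[OF beta tay H G fi lim] by blast
  define R where "R = (\<lambda>\<delta>. C * (H * \<delta> powr (\<beta> - 2 * s) + B * \<delta>))"
  have R: "(R \<longlongrightarrow> 0) (at_right 0)"
  proof -
    have "((\<lambda>\<delta>::real. \<delta> powr (\<beta> - 2 * s)) \<longlongrightarrow> 0) (at_right 0)"
    proof (rule tendsto_zero_powrI)
      show "((\<lambda>\<delta>::real. \<delta>) \<longlongrightarrow> 0) (at_right 0)" by (intro tendsto_intros)
    qed (use beta in \<open>auto intro: tendsto_const simp: eventually_at_filter\<close>)
    moreover have "((\<lambda>\<delta>::real. \<delta>) \<longlongrightarrow> 0) (at_right 0)" by (intro tendsto_intros)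
    ultimately have "((\<lambda>\<delta>. C * (H * \<delta> powr (\<beta> - 2 * s) + B * \<delta>)) \<longlongrightarrow> C * (H * 0 + B * 0)) (at_right 0)"
      by (intro tendsto_intros)
    thus ?thesis by (simp add: R_def)
  qed
  have uc: "(\<lambda>j. u (X j)) \<longlonglongrightarrow> u x"
    using continuous_on_tendsto_compose[OF hoelder_bounds(1)[OF h] X x] Xb by simp
  show ?thesis
  proof (rule LIMSEQ_I)
    fix \<eta> :: real assume eta: "0 < \<eta>"
    \<comment> \<open>With \<open>\<delta> < t / 2\<close>, every point within \<open>t / 2\<close>
      of \<open>x\<close> keeps its closed \<open>\<delta>\<close>-ball inside
      \<open>ball e \<rho>\<close>, where the Taylor bound is available.\<close>
    define t where "t = \<rho> - dist e x"
    have t: "0 < t" using x by (simp add: t_def)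
    have "\<forall>\<^sub>F \<delta> in at_right 0. R \<delta> < \<eta> / 3" using R eta by (intro order_tendstoD) auto
    moreover have "\<forall>\<^sub>F \<delta> in at_right (0::real). 0 < \<delta> \<and> \<delta> < min (t / 2) ((1 - \<rho>) / 2)"
      using t rho by (intro eventually_at_rightI[of 0 "min (t / 2) ((1 - \<rho>) / 2)"]) auto
    ultimately have ev: "\<forall>\<^sub>F \<delta> in at_right (0::real). R \<delta> < \<eta> / 3 \<and> 0 < \<delta> \<and> \<delta> < min (t / 2) ((1 - \<rho>) / 2)"
      by eventually_elim simp
    from eventually_happens'[OF trivial_limit_at_right_real ev] obtain \<delta> where "R \<delta> < \<eta> / 3 \<and> 0 < \<delta> \<and> \<delta> < min (t / 2) ((1 - \<rho>) / 2)"
      by blast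
    hence d: "R \<delta> < \<eta> / 3" "0 < \<delta>" "\<delta> < t / 2" "2 * \<delta> \<le> 1 - \<rho>" "\<delta> \<le> 1"
      using rho by auto
    define E where "E = (\<lambda>z. integral (halfspace e - cball z \<delta>) (frac_kernel_integrand s e u z))"
    have "(\<lambda>j. E (X j)) \<longlonglongrightarrow> E x" unfolding E_def
      by (rule truncated_integral_tendsto[OF X Xb x d(2,5) uc ui]) (use fi d in auto)
    from LIMSEQ_D[OF this, of "\<eta> / 3"] eta
    obtain N1 where N1: "\<And>j. j \<ge> N1 \<Longrightarrow> \<bar>E (X j) - E x\<bar> < \<eta> / 3" by auto
    have "0 < t / 2" using t by simp
    from metric_LIMSEQ_D[OF X this] obtain N2 where N2: "\<And>j. j \<ge> N2 \<Longrightarrow> dist (X j) x < t / 2" by auto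
    have sub: "cball z \<delta> \<subseteq> ball e \<rho>" if "dist z x < t / 2" for z
    proof
      fix y assume "y \<in> cball z \<delta>"
      hence "dist e y < dist e x + t / 2 + t / 2"
        using that d dist_triangle[of e y z] dist_triangle[of e z x] by (simp add: dist_commute)
      thus "y \<in> ball e \<rho>" by (simp add: t_def)
    qed
    have err: "\<bar>L z - E z\<bar> < \<eta> / 3" if "dist z x < t / 2" "z \<in> ball e \<rho>" for z
      using C'[OF that(2) d(2) d(4) sub[OF that(1)]] d(1) unfolding E_def R_def by linarith
    have "norm (L (X j) - L x) < \<eta>" if "j \<ge> max N1 N2" for j
    proof -
      have "\<bar>L (X j) - E (X j)\<bar> < \<eta> / 3" using N2 that Xb by (intro err) auto
      moreover have "\<bar>L x - E x\<bar> < \<eta> / 3" using x t by (intro err) auto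
      moreover have "\<bar>E (X j) - E x\<bar> < \<eta> / 3" using N1 that by auto
      ultimately show ?thesis unfolding real_norm_def by linarith
    qed
    thus "\<exists>N. \<forall>j\<ge>N. norm (L (X j) - L x) < \<eta>" by blast
  qed
qed

text \<open>The bound \<open>\<bar>c\<bar> \<le> M\<close> is only known almost everywhere, but the equation is pointwise.
  Since \<open>(-\<Delta>)^s u\<close> is continuous, the resulting bound on \<open>c u\<close> holds everywhere.\<close>

lemma potential_term_bound:
  assumes h: "hoelder (2 * s + \<alpha>) (ball e \<rho>) u" "0 < \<alpha>" and ui: "As_weight s e u integrable_on halfspace e"
    and u0: "\<forall>x\<in>halfspace e. 0 \<le> u x"
    and eq: "\<And>x. x \<in> ball e \<rho> \<Longrightarrow> frac_laplacian_at s e u x (- (c x * u x))"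
    and c: "AE x in lebesgue. x \<in> ball e \<rho> \<longrightarrow> \<bar>c x\<bar> \<le> M"
    and x: "x \<in> ball e \<rho>"
  shows "\<bar>c x * u x\<bar> \<le> M * u x"
proof -
  have fi: "\<And>x \<epsilon>. x \<in> ball e \<rho> \<Longrightarrow> 0 < \<epsilon> \<Longrightarrow> frac_kernel_integrand s e u x absolutely_integrable_on (halfspace e - ball x \<epsilon>)"
    using eq unfolding frac_laplacian_at_def by blast
  have "\<forall>x\<in>ball e \<rho>. \<exists>L. ((\<lambda>\<epsilon>. integral (halfspace e - ball x \<epsilon>) (frac_kernel_integrand s e u x)) \<longlongrightarrow> L) (at_right 0) \<and>
          - (c x * u x) = c_ns DIM('a) s * L + c_ns 1 s / s * u x * (x \<bullet> e) powr (- 2 * s)"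
    using eq unfolding frac_laplacian_at_def by blast
  then obtain L where lim: "\<And>x. x \<in> ball e \<rho> \<Longrightarrow> ((\<lambda>\<epsilon>. integral (halfspace e - ball x \<epsilon>) (frac_kernel_integrand s e u x)) \<longlongrightarrow> L x) (at_right 0)"
    and L: "\<And>x. x \<in> ball e \<rho> \<Longrightarrow> - (c x * u x) = c_ns DIM('a) s * L x + c_ns 1 s / s * u x * (x \<bullet> e) powr (- 2 * s)"
    by metis
  obtain N where N: "negligible N" "{x. \<not> (x \<in> ball e \<rho> \<longrightarrow> \<bar>c x\<bar> \<le> M)} \<subseteq> N"
    using c unfolding eventually_ae_filter_negligible by blast
  \<comment> \<open>A nonempty open set cannot be swallowed by the null set \<open>N\<close>, so
    points at which the bound holds accumulate at \<open>x\<close>.\<close>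
  have "\<exists>z. z \<in> ball e \<rho> \<and> \<bar>c z\<bar> \<le> M \<and> dist z x < 1 / real (Suc j)" for j
  proof (rule ccontr)
    assume "\<not> ?thesis"
    hence "ball e \<rho> \<inter> ball x (1 / real (Suc j)) \<subseteq> N" using N(2) by (auto simp: dist_commute)
    hence "negligible (ball e \<rho> \<inter> ball x (1 / real (Suc j)))" using N(1) negligible_subset by blast
    moreover have "open (ball e \<rho> \<inter> ball x (1 / real (Suc j)))" by auto
    moreover have "x \<in> ball e \<rho> \<inter> ball x (1 / real (Suc j))" using x by auto
    ultimately show False using open_not_negligible by blast
  qed
  then obtain X where Xb: "\<And>j. X j \<in> ball e \<rho>" and Xc: "\<And>j. \<bar>c (X j)\<bar> \<le> M" and Xd: "\<And>j. dist (X j) x < 1 / real (Suc j)"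
    by metis
  have X: "X \<longlonglongrightarrow> x"
  proof (rule metric_LIMSEQ_I)
    fix r :: real assume "0 < r"
    then obtain n where "inverse (real (Suc n)) < r" using reals_Archimedean by blast
    hence n: "1 / real (Suc n) < r" by (simp add: inverse_eq_divide)
    have "dist (X j) x < r" if "j \<ge> n" for j
    proof -
      have "1 / real (Suc j) \<le> 1 / real (Suc n)" using that by (intro divide_left_mono) auto
      thus ?thesis using Xd[of j] n by linarith
    qed
    thus "\<exists>no. \<forall>n\<ge>no. dist (X n) x < r" by blast
  qed
  have LX: "(\<lambda>j. L (X j)) \<longlonglongrightarrow> L x" by (rule principal_value_tendsto[OF h ui fi lim X Xb x])
  have uX: "(\<lambda>j. u (X j)) \<longlonglongrightarrow> u x"
    using continuous_on_tendsto_compose[OF hoelder_bounds(1)[OF h] X x] Xb by simp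
  have "(\<lambda>j. c_ns DIM('a) s * L (X j) + c_ns 1 s / s * u (X j) * (X j \<bullet> e) powr (- 2 * s))
      \<longlonglongrightarrow> c_ns DIM('a) s * L x + c_ns 1 s / s * u x * (x \<bullet> e) powr (- 2 * s)"
    using ball_e(1)[OF x] rho by (intro tendsto_intros LX uX X) auto
  \<comment> \<open>The coefficient itself need not converge along \<open>X\<close>; its product
    with \<open>u\<close> does, because the equation expresses it through continuous
    quantities.\<close>
  hence "(\<lambda>j. - (c (X j) * u (X j))) \<longlonglongrightarrow> - (c x * u x)"
    using L Xb x by simp
  hence l1: "(\<lambda>j. \<bar>- (c (X j) * u (X j))\<bar>) \<longlonglongrightarrow> \<bar>- (c x * u x)\<bar>" by (rule tendsto_rabs)
  have l2: "(\<lambda>j. M * u (X j)) \<longlonglongrightarrow> M * u x" by (intro tendsto_intros uX)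
  have "\<bar>- (c x * u x)\<bar> \<le> M * u x"
  proof (rule LIMSEQ_le[OF l1 l2], intro exI allI impI)
    fix j
    have "0 \<le> u (X j)" using u0 ball_e(4)[OF Xb] by blast
    thus "\<bar>- (c (X j) * u (X j))\<bar> \<le> M * u (X j)" using Xc[of j] by (simp add: abs_mult mult_right_mono)
  qed
  thus ?thesis by simp
qed

end

section \<open>Bounds by the weighted norm\<close>

lemma norm_sq_expand:
  fixes x y z :: "'a::real_inner"
  shows "(norm (y - z))\<^sup>2 = (norm (x - z))\<^sup>2 + 2 * ((x - z) \<bullet> (y - x)) + (norm (y - x))\<^sup>2"
  by (simp add: power2_norm_eq_inner inner_diff_left inner_diff_right inner_commute)

lemma c_ns_pos:
  assumes "0 < s" "s < 1"
  shows "0 < c_ns n s"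
proof -
  have "0 < Gamma ((real n + 2 * s) / 2)" "0 < Gamma (1 - s)"
    using assms by (auto intro!: Gamma_real_pos add_nonneg_pos)
  thus ?thesis using assms by (simp add: c_ns_def)
qed

section \<open>Functions whose principal value is bounded by a multiple of their value\<close>

context antisym_setting
begin

text \<open>The interface between the equation and the two touching arguments. Neither the potential
  nor any Hoelder data appears in it, so constants derived from it depend only on \<open>K\<close>
  and on the parameters of the locale.\<close>

definition controlled :: "real \<Rightarrow> ('a \<Rightarrow> real) \<Rightarrow> bool" where
  "controlled K u \<longleftrightarrow> (\<forall>y\<in>halfspace e. 0 \<le> u y) \<and> As_weight s e u integrable_on halfspace e \<and>
     continuous_on (ball e \<rho>) u \<and>
     (\<forall>x\<in>ball e \<rho>. (\<forall>\<epsilon>>0. frac_kernel_integrand s e u x integrable_on (halfspace e - ball x \<epsilon>)) \<and>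
       (\<exists>L. ((\<lambda>\<epsilon>. integral (halfspace e - ball x \<epsilon>) (frac_kernel_integrand s e u x)) \<longlongrightarrow> L) (at_right 0) \<and>
         - K * u x \<le> L \<and> L \<le> K * u x))"

lemma As_norm_nonneg: "controlled K u \<Longrightarrow> 0 \<le> As_norm s e u"
  unfolding controlled_def As_norm_def
  using wt_nonneg by (intro integral_nonneg) (auto simp: As_weight_eq)

lemma solution_controlled:
  assumes M: "0 \<le> M"
  shows "\<exists>K>0. \<forall>c u \<alpha>. (AE x in lebesgue. x \<in> ball e \<rho> \<longrightarrow> \<bar>c x\<bar> \<le> M) \<longrightarrow> 0 < \<alpha> \<longrightarrow>
    hoelder (2 * s + \<alpha>) (ball e \<rho>) u \<longrightarrow> As_space s e u \<longrightarrow> (\<forall>x\<in>halfspace e. 0 \<le> u x) \<longrightarrow>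
    (\<forall>x\<in>ball e \<rho>. frac_laplacian_at s e u x (- (c x * u x))) \<longrightarrow> controlled K u"
proof -
  define a where "a = c_ns DIM('a) s"
  define b where "b = c_ns 1 s / s"
  have a: "0 < a" and b: "0 < b" using s c_ns_pos[OF s] by (auto simp: a_def b_def)
  define t where "t = (1 - \<rho>) powr (- 2 * s)"
  have t: "0 < t" using rho by (simp add: t_def)
  \<comment> \<open>The pointwise equation is solved for the principal value: the potential
    contributes \<open>M\<close>, the boundary term of the operator at most \<open>b * t\<close>
    since the first coordinate exceeds \<open>1 - \<rho>\<close>, and \<open>a\<close> is the
    normalising constant in front of the limit.\<close>
  define K where "K = (M + b * t) / a"
  have K: "0 < K" using M a b t by (simp add: K_def add_nonneg_pos)
  have "controlled K u"
    if c: "AE x in lebesgue. x \<in> ball e \<rho> \<longrightarrow> \<bar>c x\<bar> \<le> M" and al: "0 < \<alpha>"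
      and h: "hoelder (2 * s + \<alpha>) (ball e \<rho>) u" and As: "As_space s e u" and u0: "\<forall>x\<in>halfspace e. 0 \<le> u x"
      and eq: "\<forall>x\<in>ball e \<rho>. frac_laplacian_at s e u x (- (c x * u x))" for c u \<alpha>
  proof -
    have ui: "As_weight s e u integrable_on halfspace e" using As by (simp add: As_space_def)
    have pt: "(\<forall>\<epsilon>>0. frac_kernel_integrand s e u x integrable_on (halfspace e - ball x \<epsilon>)) \<and>
       (\<exists>L. ((\<lambda>\<epsilon>. integral (halfspace e - ball x \<epsilon>) (frac_kernel_integrand s e u x)) \<longlongrightarrow> L) (at_right 0) \<and>
         - K * u x \<le> L \<and> L \<le> K * u x)" if x: "x \<in> ball e \<rho>" for x
    proof -
      have fl: "frac_laplacian_at s e u x (- (c x * u x))" using eq x by blast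
      have 1: "\<forall>\<epsilon>>0. frac_kernel_integrand s e u x integrable_on (halfspace e - ball x \<epsilon>)"
        using fl unfolding frac_laplacian_at_def by (blast intro: set_lebesgue_integral_eq_integral(1))
      obtain L where L: "((\<lambda>\<epsilon>. integral (halfspace e - ball x \<epsilon>) (frac_kernel_integrand s e u x)) \<longlongrightarrow> L) (at_right 0)"
        and Leq: "- (c x * u x) = a * L + b * u x * (x \<bullet> e) powr (- 2 * s)"
        using fl unfolding frac_laplacian_at_def a_def b_def by blast
      have ux: "0 \<le> u x" using u0 ball_e(4)[OF x] by blast
      have cu: "\<bar>c x * u x\<bar> \<le> M * u x"
        using potential_term_bound[OF h al ui u0 _ c x] eq by blast
      have "(x \<bullet> e) powr (- 2 * s) \<le> t" unfolding t_def using ball_e(1)[OF x] rho s by (intro powr_mono2') auto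
      hence "b * u x * (x \<bullet> e) powr (- 2 * s) \<le> b * u x * t" using b ux by (intro mult_left_mono) auto
      moreover have "0 \<le> b * u x * (x \<bullet> e) powr (- 2 * s)" using b ux by simp
      moreover have aK: "a * (K * u x) = M * u x + b * u x * t" using a by (simp add: K_def field_simps)
      moreover have "0 \<le> b * u x * t" using b ux t by simp
      ultimately have "a * L \<le> a * (K * u x)" "a * (- (K * u x)) \<le> a * L" using Leq cu by linarith+
      hence "L \<le> K * u x" "- (K * u x) \<le> L" using a by (simp_all only: mult_le_cancel_left_pos)
      thus ?thesis using 1 L by auto
    qed
    show ?thesis unfolding controlled_def using u0 ui hoelder_bounds(1)[OF h al] pt by blast
  qed
  thus ?thesis using K by (intro exI[of _ K] conjI) auto
qed

text \<open>The maximum of \<open>u x * (r - \<bar>x - e\<bar>) ^ N\<close> localises the problem to a ball around \<open>x0\<close> whose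
  radius is comparable to the distance \<open>d\<close> to the boundary and on which \<open>u\<close> is at most a multiple
  of \<open>u x0\<close>. There a paraboloid of opening comparable to \<open>u x0 / d\<^sup>2\<close> touches \<open>u\<close> from above.\<close>

lemma upper_paraboloid:
  assumes ctr: "controlled K u" and r: "0 < r" "r < \<rho>" and x: "x \<in> ball e r" "0 < u x"
    and N: "0 < N"
  shows "\<exists>x1 d b A. 0 < d \<and> d \<le> 1 \<and> x1 \<in> ball e \<rho> \<and> 0 < u x1 \<and> 0 \<le> A \<and>
    A * d\<^sup>2 \<le> 2 ^ (N + 3) * u x1 \<and> norm b * d \<le> 2 ^ (N + 3) * u x1 \<and>
    (\<forall>y\<in>cball x1 (d / 8). y \<in> ball e \<rho> \<and> u y - u x1 \<le> b \<bullet> (y - x1) + A * (norm (y - x1))\<^sup>2) \<and>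
    u x * (r - dist e x) ^ N \<le> u x1 * d ^ N"
proof -
  have u0: "\<And>y. y \<in> halfspace e \<Longrightarrow> 0 \<le> u y" and uc: "continuous_on (ball e \<rho>) u"
    using ctr by (auto simp: controlled_def)
  have ub: "0 \<le> u y" if "y \<in> ball e \<rho>" for y using u0 ball_e(4)[OF that] by blast
  have sub: "cball e r \<subseteq> ball e \<rho>" using r by auto
  \<comment> \<open>The factor vanishes on the sphere of radius \<open>r\<close>, so a positive
    maximum is attained inside.\<close>
  define F where "F = (\<lambda>y. u y * (r - dist e y) ^ N)"
  have "continuous_on (cball e r) F" unfolding F_def
    by (intro continuous_intros continuous_on_subset[OF uc sub])
  then obtain x0 where x0: "x0 \<in> cball e r" and mx: "\<And>y. y \<in> cball e r \<Longrightarrow> F y \<le> F x0"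
    using continuous_attains_sup[of "cball e r" F] r by auto
  define d' where "d' = r - dist e x0"
  have Fx: "0 < F x" unfolding F_def using x by simp
  have Fx0: "F x \<le> F x0" using x by (intro mx) auto
  have d0: "0 \<le> d'" using x0 by (simp add: d'_def)
  have ux0: "0 \<le> u x0" using ub x0 sub by blast
  have "0 < u x0 * d' ^ N" using Fx Fx0 by (simp add: F_def d'_def)
  hence up: "0 < u x0" and d: "0 < d'" using ux0 d0 N by (auto simp: zero_less_mult_iff zero_less_power_eq power_0_left le_less)
  \<comment> \<open>On the ball of radius \<open>d' / 2\<close> one has
    \<open>u y \<le> 2 ^ N * u x0\<close>. The extra factor 8 confines the touching point to within
    \<open>3 / 8 * d'\<close> of \<open>x0\<close>, so that a ball of radius \<open>d' / 8\<close>
    about it still fits into that ball.\<close>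
  define A where "A = 2 ^ (N + 3) * u x0 / d'\<^sup>2"
  have A: "0 < A" using up d by (simp add: A_def)
  have Ad: "A * d'\<^sup>2 = 2 ^ (N + 3) * u x0" using d by (simp add: A_def)
  have inr: "dist e y \<le> r - d' / 2" if "y \<in> cball x0 (d' / 2)" for y
    proof -
    have "dist x0 y \<le> d' / 2" using that by simp
    moreover have "dist e x0 = r - d'" by (simp add: d'_def)
    ultimately show ?thesis using dist_triangle[of e y x0] by linarith
  qed
  have subd: "cball x0 (d' / 2) \<subseteq> ball e \<rho>" using inr d r by force
  have grow: "u y \<le> 2 ^ N * u x0" if "y \<in> cball x0 (d' / 2)" for y
  proof -
    have "u y * (d' / 2) ^ N \<le> u y * (r - dist e y) ^ N"
      using inr[OF that] d ub[of y] subd that by (intro mult_left_mono power_mono) auto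
    also have "\<dots> \<le> u x0 * d' ^ N" using mx[of y] inr[OF that] d by (simp add: F_def d'_def)
    finally have "u y * d' ^ N \<le> (2 ^ N * u x0) * d' ^ N" by (simp add: power_divide field_simps)
    thus ?thesis using d by simp
  qed
  \<comment> \<open>At a maximum of \<open>v\<close> a vertical translate of the paraboloid touches
    \<open>u\<close> from above.\<close>
  define v where "v = (\<lambda>y. u y - A * (norm (y - x0))\<^sup>2)"
  have "continuous_on (cball x0 (d' / 2)) v" unfolding v_def
    by (intro continuous_intros continuous_on_subset[OF uc subd])
  then obtain x1 where x1: "x1 \<in> cball x0 (d' / 2)" and mv: "\<And>y. y \<in> cball x0 (d' / 2) \<Longrightarrow> v y \<le> v x1"
    using continuous_attains_sup[of "cball x0 (d' / 2)" v] d by auto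
  have "v x0 \<le> v x1" using d by (intro mv) auto
  hence v1: "u x0 + A * (norm (x1 - x0))\<^sup>2 \<le> u x1" by (simp add: v_def)
  have nn: "0 \<le> A * (norm (x1 - x0))\<^sup>2" using A by simp
  have U: "u x0 \<le> u x1" using v1 nn by linarith
  have "A * (norm (x1 - x0))\<^sup>2 \<le> 2 ^ N * u x0" using v1 grow[OF x1] up by linarith
  also have "\<dots> = A * (d'\<^sup>2 / 8)" using Ad by (simp add: power_add)
  finally have "(norm (x1 - x0))\<^sup>2 \<le> d'\<^sup>2 / 8" using A by simp
  also have "\<dots> \<le> (3 / 8 * d')\<^sup>2" by (simp add: power_mult_distrib power_divide)
  finally have close: "norm (x1 - x0) \<le> 3 / 8 * d'" by (rule power2_le_imp_le) (use d in simp)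
  \<comment> \<open>The gradient at \<open>x1\<close> of the paraboloid centred at
    \<open>x0\<close>.\<close>
  define b where "b = (2 * A) *\<^sub>R (x1 - x0)"
  have "norm b * d' \<le> (2 * A * (3 / 8 * d')) * d'"
    unfolding b_def using A close d by (intro mult_right_mono) auto
  also have "\<dots> \<le> A * d'\<^sup>2" using A by (simp add: power2_eq_square)
  also have "\<dots> \<le> 2 ^ (N + 3) * u x1" unfolding Ad using U by (intro mult_left_mono) auto
  finally have nb: "norm b * d' \<le> 2 ^ (N + 3) * u x1" .
  have in8: "y \<in> cball x0 (d' / 2)" if "y \<in> cball x1 (d' / 8)" for y
    using that close dist_triangle[of x0 y x1] by (simp add: dist_norm norm_minus_commute)
  have touch: "u y - u x1 \<le> b \<bullet> (y - x1) + A * (norm (y - x1))\<^sup>2" if "y \<in> cball x1 (d' / 8)" for y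
  proof -
    have "u y - u x1 \<le> A * ((norm (y - x0))\<^sup>2 - (norm (x1 - x0))\<^sup>2)"
      using mv[OF in8[OF that]] by (simp add: v_def right_diff_distrib)
    also have "\<dots> = b \<bullet> (y - x1) + A * (norm (y - x1))\<^sup>2"
      unfolding norm_sq_expand[of y x0 x1] by (simp add: b_def algebra_simps)
    finally show ?thesis .
  qed
  have "u x * (r - dist e x) ^ N \<le> u x0 * d' ^ N" using Fx0 by (simp add: F_def d'_def)
  also have "\<dots> \<le> u x1 * d' ^ N" using U d by (intro mult_right_mono) auto
  finally have fin: "u x * (r - dist e x) ^ N \<le> u x1 * d' ^ N" .
  have d1: "d' \<le> 1" using r rho by (simp add: d'_def) (smt (verit) zero_le_dist)
  have Ad2: "A * d'\<^sup>2 \<le> 2 ^ (N + 3) * u x1" unfolding Ad using U by (intro mult_left_mono) auto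
  show ?thesis
  proof (rule exI[of _ x1], rule exI[of _ d'], rule exI[of _ b], rule exI[of _ A], intro conjI ballI)
    show "x1 \<in> ball e \<rho>" using x1 subd by blast
    show "0 < u x1" using U up by linarith
    show "0 \<le> A" using A by simp
    show "y \<in> ball e \<rho>" if "y \<in> cball x1 (d' / 8)" for y using in8[OF that] subd by blast
  qed (fact d d1 Ad2 nb touch fin)+
qed

text \<open>With \<open>\<delta> = \<theta> * d\<close> and an opening of order
  \<open>u x1 / d\<^sup>2\<close>, both paraboloid errors are at most a multiple of
  \<open>\<theta> * u x1 * \<delta> powr (- 2 * s)\<close>, which a small \<open>\<theta>\<close>
  makes negligible against the gain. What remains bounds \<open>u x1\<close> by
  \<open>As_norm\<close> times \<open>d powr (- q - 2)\<close>; the factor \<open>d ^ N\<close>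
  delivered by \<open>upper_paraboloid\<close> compensates this blow-up.\<close>

lemma sup_le_As_norm:
  assumes K: "0 < K"
  shows "\<exists>C>0. \<forall>u. controlled K u \<longrightarrow> (\<forall>x\<in>ball e (\<rho>/2). u x \<le> C * As_norm s e u)"
proof -
  obtain c C where c: "0 < c" and C: "0 < C" and ut0: "\<forall>x\<in>ball e \<rho>. \<forall>u b A \<delta> \<epsilon>.
    (\<forall>y\<in>halfspace e. 0 \<le> u y) \<longrightarrow> As_weight s e u integrable_on halfspace e \<longrightarrow>
    0 < \<delta> \<longrightarrow> 2 * \<delta> \<le> 1 - \<rho> \<longrightarrow> 0 < \<epsilon> \<longrightarrow> 2 * \<epsilon> \<le> \<delta> \<longrightarrow> 0 \<le> A \<longrightarrow>
    (\<forall>y\<in>cball x \<delta>. u y - u x \<le> b \<bullet> (y - x) + A * (norm (y - x))\<^sup>2) \<longrightarrow>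
    frac_kernel_integrand s e u x integrable_on (halfspace e - ball x \<epsilon>) \<longrightarrow>
    c * u x * \<delta> powr (- 2 * s) - C * A * \<delta> powr (2 - 2 * s) - C * norm b * \<delta>
      - C * \<delta> powr (- q - 2) * As_norm s e u
    \<le> integral (halfspace e - ball x \<epsilon>) (frac_kernel_integrand s e u x)"
    using upper_touch by (elim exE conjE)
  note ut = ut0[rule_format]
  \<comment> \<open>The exponent has to be at least \<open>q + 2\<close>, which is the dimension
    plus \<open>2 * s + 2\<close>; \<open>s < 1\<close> makes this choice sufficient.\<close>
  define N where "N = DIM('a) + 4"
  have N: "0 < N" by (simp add: N_def)
  define P where "P = (2::real) ^ (N + 3)"
  have P: "0 < P" by (simp add: P_def)
  \<comment> \<open>The first pair of bounds keeps the ball inside the touching region and away from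
    the hyperplane. The third makes each paraboloid error at most a quarter of the gain, and the
    fourth does the same for the bound \<open>K * u x1\<close> of the principal value.\<close>
  define \<theta> where "\<theta> = min (min (1 / 8) ((1 - \<rho>) / 2)) (min (c / (4 * C * P)) ((4 * K / c) powr (- 1 / (2 * s))))"
  have th: "0 < \<theta>" "\<theta> \<le> 1 / 8" "\<theta> \<le> (1 - \<rho>) / 2" "\<theta> \<le> c / (4 * C * P)" "\<theta> \<le> (4 * K / c) powr (- 1 / (2 * s))"
    
  proof -
    have "\<theta> \<le> min (1 / 8) ((1 - \<rho>) / 2)" "\<theta> \<le> min (c / (4 * C * P)) ((4 * K / c) powr (- 1 / (2 * s)))"
      unfolding \<theta>_def by (rule min.cobounded1, rule min.cobounded2)
    thus "\<theta> \<le> 1 / 8" "\<theta> \<le> (1 - \<rho>) / 2" "\<theta> \<le> c / (4 * C * P)" "\<theta> \<le> (4 * K / c) powr (- 1 / (2 * s))"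
      by (simp_all only: min.bounded_iff)
    show "0 < \<theta>" using rho c C P K by (simp add: \<theta>_def)
  qed
  define C' where "C' = 4 * C / c * \<theta> powr (- q - 2)"
  have C': "0 < C'" using c C th by (simp add: C'_def)
  have "u x \<le> C' * (4 / \<rho>) ^ N * As_norm s e u" if ctr: "controlled K u" and x: "x \<in> ball e (\<rho>/2)" for u x
  proof (cases "0 < u x")
    case False
    have "0 \<le> C' * (4 / \<rho>) ^ N * As_norm s e u" using C' rho As_norm_nonneg[OF ctr] by simp
    thus ?thesis using False by linarith
  next
    case True
    define J where "J = As_norm s e u"
    have J: "0 \<le> J" unfolding J_def by (rule As_norm_nonneg[OF ctr])
    have x': "x \<in> ball e (3 / 4 * \<rho>)" using x rho by auto
    \<comment> \<open>A radius strictly between \<open>\<rho> / 2\<close> and \<open>\<rho>\<close>: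
      points of \<open>ball e (\<rho>/2)\<close> keep distance at least \<open>\<rho> / 4\<close>
      from its boundary, which bounds the weight from below in the end.\<close>
    have r: "0 < 3 / 4 * \<rho>" "3 / 4 * \<rho> < \<rho>" using rho by auto
    obtain x1 d b A where d: "0 < d" "d \<le> 1" and x1: "x1 \<in> ball e \<rho>" and Upos: "0 < u x1" and A: "0 \<le> A"
      and Ad0: "A * d\<^sup>2 \<le> P * u x1" and bd0: "norm b * d \<le> P * u x1"
      and touch0: "\<forall>y\<in>cball x1 (d / 8). y \<in> ball e \<rho> \<and> u y - u x1 \<le> b \<bullet> (y - x1) + A * (norm (y - x1))\<^sup>2"
      and fin0: "u x * (3 / 4 * \<rho> - dist e x) ^ N \<le> u x1 * d ^ N"
      using upper_paraboloid[OF ctr r x' True N] unfolding P_def by (elim exE conjE)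
    define U where "U = u x1"
    have U: "U = u x1" "0 < U" and Ad: "A * d\<^sup>2 \<le> P * U" and bd: "norm b * d \<le> P * U"
      and fin: "u x * (3 / 4 * \<rho> - dist e x) ^ N \<le> U * d ^ N"
      using Upos Ad0 bd0 fin0 by (simp_all add: U_def)
    note touch = touch0[rule_format]
    define \<delta> where "\<delta> = \<theta> * d"
    have dl: "0 < \<delta>" "\<delta> \<le> \<theta>" using th d by (auto simp: \<delta>_def mult_left_le)
    have dl2: "\<delta> \<le> d / 8" "2 * \<delta> \<le> 1 - \<rho>" "\<delta> \<le> 1"
    proof -
      show "\<delta> \<le> d / 8" using mult_right_mono[OF th(2), of d] d by (simp add: \<delta>_def)
      show "2 * \<delta> \<le> 1 - \<rho>" 
      proof -
        have "2 * \<delta> \<le> 2 * \<theta>" using dl(2) by simp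
        also have "\<dots> \<le> 2 * ((1 - \<rho>) / 2)" using th(3) by (rule mult_left_mono) simp
        finally show ?thesis by simp
      qed
      show "\<delta> \<le> 1" using dl(2) th(2) by linarith
    qed
    obtain L where lim: "((\<lambda>\<epsilon>. integral (halfspace e - ball x1 \<epsilon>) (frac_kernel_integrand s e u x1)) \<longlongrightarrow> L) (at_right 0)"
      and L: "L \<le> K * u x1" and fi: "\<And>\<epsilon>. 0 < \<epsilon> \<Longrightarrow> frac_kernel_integrand s e u x1 integrable_on (halfspace e - ball x1 \<epsilon>)"
      using ctr x1 unfolding controlled_def by blast
    define T where "T = \<delta> powr (- 2 * s)"
    have T1: "1 \<le> T" unfolding T_def using dl dl2 s powr_mono2'[of "- 2 * s" \<delta> 1] by simp
    have "\<forall>\<^sub>F \<epsilon> in at_right (0::real). 0 < \<epsilon> \<and> \<epsilon> < \<delta> / 2"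
      using dl by (intro eventually_at_rightI[of 0 "\<delta> / 2"]) auto
    hence "\<forall>\<^sub>F \<epsilon> in at_right 0. c * u x1 * \<delta> powr (- 2 * s) - C * A * \<delta> powr (2 - 2 * s) - C * norm b * \<delta>
      - C * \<delta> powr (- q - 2) * As_norm s e u
      \<le> integral (halfspace e - ball x1 \<epsilon>) (frac_kernel_integrand s e u x1)"
    proof eventually_elim
      case (elim \<epsilon>)
      show ?case using ctr elim touch dl2
        by (intro ut[OF x1 _ _ dl(1) dl2(2) _ _ A _ fi]) (auto simp: controlled_def)
    qed
    hence "c * u x1 * \<delta> powr (- 2 * s) - C * A * \<delta> powr (2 - 2 * s) - C * norm b * \<delta>
      - C * \<delta> powr (- q - 2) * As_norm s e u \<le> L"
      by (intro tendsto_lowerbound[OF lim]) auto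
    hence main: "c * U * T - C * A * \<delta> powr (2 - 2 * s) - C * norm b * \<delta> - C * \<delta> powr (- q - 2) * J \<le> K * U"
      using L by (simp add: U J_def T_def)
    have "A * \<delta> powr (2 - 2 * s) = A * d\<^sup>2 * (\<theta>\<^sup>2 * T)"
      using dl powr_add[of \<delta> 2 "- 2 * s"] by (simp add: \<delta>_def T_def power_mult_distrib mult_ac)
    also have "\<dots> \<le> (P * U) * (\<theta>\<^sup>2 * T)" using Ad T1 by (intro mult_right_mono) auto
    also have "\<dots> \<le> (P * U) * (\<theta> * T)"
    proof -
      have "\<theta> * \<theta> \<le> \<theta> * 1" using th by (intro mult_left_mono) auto
      thus ?thesis using P U T1 by (intro mult_left_mono mult_right_mono) (auto simp: power2_eq_square)
    qed
    finally have "C * (A * \<delta> powr (2 - 2 * s)) \<le> C * ((P * U) * (\<theta> * T))" using C by (intro mult_left_mono) auto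
    hence e1: "C * A * \<delta> powr (2 - 2 * s) \<le> C * P * \<theta> * U * T" by (simp add: mult_ac)
    have "norm b * \<delta> = (norm b * d) * \<theta>" by (simp add: \<delta>_def)
    also have "\<dots> \<le> (P * U) * \<theta>" using bd th by (intro mult_right_mono) auto
    also have "\<dots> \<le> (P * U) * \<theta> * T" using P U th T1 mult_left_mono[of 1 T "P * U * \<theta>"] by simp
    finally have "C * (norm b * \<delta>) \<le> C * ((P * U) * \<theta> * T)" using C by (intro mult_left_mono) auto
    hence e2: "C * norm b * \<delta> \<le> C * P * \<theta> * U * T" by (simp add: mult_ac)
    have "C * P * \<theta> \<le> c / 4" using th(4) C P by (simp add: field_simps)
    hence "C * P * \<theta> * (U * T) \<le> c / 4 * (U * T)" using U T1 by (intro mult_right_mono) auto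
    hence e3: "C * P * \<theta> * U * T \<le> c / 4 * U * T" by (simp add: mult.assoc)
    have "4 * K / c \<le> T"
    proof -
      have "4 * K / c = ((4 * K / c) powr (- 1 / (2 * s))) powr (- 2 * s)"
        using s K c by (simp add: powr_powr)
      also have "\<dots> \<le> \<theta> powr (- 2 * s)" using th s by (intro powr_mono2') auto
      also have "\<dots> \<le> T" unfolding T_def using dl s by (intro powr_mono2') auto
      finally show ?thesis .
    qed
    hence "K \<le> c / 4 * T" using c by (simp add: field_simps)
    hence "K * U \<le> c / 4 * T * U" using U by (intro mult_right_mono) auto
    \<comment> \<open>The two paraboloid errors and the principal value consume three quarters of
      the gain \<open>c * U * T\<close>; one quarter is left.\<close>
    hence "c / 4 * U * T \<le> C * \<delta> powr (- q - 2) * J" using main e1 e2 e3 by (simp add: algebra_simps)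
    moreover have "c / 4 * U * 1 \<le> c / 4 * U * T" using c U T1 by (intro mult_left_mono) auto
    ultimately have "c / 4 * U \<le> C * \<delta> powr (- q - 2) * J" by simp
    hence "U \<le> 4 * C / c * \<delta> powr (- q - 2) * J" using c by (simp add: field_simps)
    also have "\<dots> = C' * d powr (- q - 2) * J" using th d by (simp add: C'_def \<delta>_def powr_mult)
    also have "\<dots> \<le> C' * d powr (- real N) * J"
      using C' J d s by (intro mult_right_mono mult_left_mono powr_mono') (auto simp: N_def q_def)
    finally have "U * d ^ N \<le> (C' * d powr (- real N) * J) * d ^ N" using d by (intro mult_right_mono) auto
    also have "\<dots> = C' * J" using d by (simp add: powr_minus powr_realpow)
    finally have UN: "u x * (3 / 4 * \<rho> - dist e x) ^ N \<le> C' * J" using fin by linarith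
    have "u x * (\<rho> / 4) ^ N \<le> u x * (3 / 4 * \<rho> - dist e x) ^ N"
      using True x rho by (intro mult_left_mono power_mono) auto
    hence "u x * (\<rho> / 4) ^ N \<le> C' * J" using UN by linarith
    hence "u x * (\<rho> / 4) ^ N * (4 / \<rho>) ^ N \<le> C' * J * (4 / \<rho>) ^ N" using rho by (intro mult_right_mono) auto
    moreover have "(\<rho> / 4) ^ N * (4 / \<rho>) ^ N = 1" using rho by (simp add: power_mult_distrib[symmetric])
    ultimately show ?thesis by (simp add: J_def mult_ac)
  qed
  thus ?thesis using C' rho by (intro exI[of _ "C' * (4 / \<rho>) ^ N"] conjI allI impI ballI) auto
qed

text \<open>No weighted maximum is required here: nonnegativity of \<open>u\<close> confines the
  touching point to a neighbourhood of \<open>xb\<close>, its value is at most \<open>u xb\<close>,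
  and the opening and slope of the paraboloid are multiples of \<open>u xb\<close> up to an
  arbitrarily small slack.\<close>

lemma As_norm_le_inf:
  assumes K: "0 < K"
  shows "\<exists>C>0. \<forall>u. controlled K u \<longrightarrow> (\<forall>x\<in>ball e (\<rho>/2). As_norm s e u \<le> C * u x)"
proof -
  \<comment> \<open>The touching point lies within \<open>3 / 16 * \<rho>\<close> of
    \<open>xb\<close>, and the minimisation takes place in a ball of radius
    \<open>\<rho> / 4\<close>; \<open>\<rho> / 16\<close> is the room left.\<close>
  define \<delta> where "\<delta> = min (\<rho> / 16) ((1 - \<rho>) / 2)"
  have dl: "0 < \<delta>" "2 * \<delta> \<le> 1 - \<rho>" "\<delta> \<le> \<rho> / 16" using rho by (auto simp: \<delta>_def min_def)
  obtain k C where k: "0 < k" and C: "0 < C" and lt0: "\<forall>x\<in>ball e \<rho>. \<forall>u b A \<epsilon>.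
    (\<forall>y\<in>halfspace e. 0 \<le> u y) \<longrightarrow> As_weight s e u integrable_on halfspace e \<longrightarrow>
    0 < \<epsilon> \<longrightarrow> \<epsilon> \<le> \<delta> \<longrightarrow> 0 \<le> A \<longrightarrow>
    (\<forall>y\<in>cball x \<delta>. u x - u y \<le> b \<bullet> (y - x) + A * (norm (y - x))\<^sup>2) \<longrightarrow>
    frac_kernel_integrand s e u x integrable_on (halfspace e - ball x \<epsilon>) \<longrightarrow>
    integral (halfspace e - ball x \<epsilon>) (frac_kernel_integrand s e u x)
      \<le> C * (u x + A + norm b) - k * integral (halfspace e - ball x \<epsilon>) (As_weight s e u)"
    using lower_touch[OF dl(1,2)] by (elim exE conjE)
  note lt = lt0[rule_format]
  \<comment> \<open>The term \<open>64 / \<rho>\<^sup>2\<close> comes from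
    \<open>A + norm b \<le> 2 * A\<close> with
    \<open>A = 32 * (m + \<kappa>) / \<rho>\<^sup>2\<close>.\<close>
  define C' where "C' = (C * (1 + 64 / \<rho>\<^sup>2) + K) / k"
  have C': "0 < C'" using C K k rho by (auto simp: C'_def intro!: divide_pos_pos add_nonneg_pos mult_nonneg_nonneg)
  have "As_norm s e u \<le> C' * u xb" if ctr: "controlled K u" and xb: "xb \<in> ball e (\<rho>/2)" for u xb
  proof -
    define J where "J = As_norm s e u"
    define m where "m = u xb"
    have u0: "\<And>y. y \<in> halfspace e \<Longrightarrow> 0 \<le> u y" and uc: "continuous_on (ball e \<rho>) u"
      and ui: "As_weight s e u integrable_on halfspace e"
      using ctr by (auto simp: controlled_def)
    have ub: "0 \<le> u y" if "y \<in> ball e \<rho>" for y using u0 ball_e(4)[OF that] by blast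
    have sub: "cball xb (\<rho> / 4) \<subseteq> ball e \<rho>"
    proof
      fix y assume "y \<in> cball xb (\<rho> / 4)"
      thus "y \<in> ball e \<rho>" using xb rho dist_triangle[of e y xb] by simp
    qed
    have m0: "0 \<le> m" unfolding m_def by (rule ub, rule subsetD[OF sub]) (use rho in simp)
    \<comment> \<open>The slack \<open>\<kappa>\<close> keeps the opening of the paraboloid positive
      even if \<open>u xb = 0\<close>; it is sent to zero at the end.\<close>
    have main: "J \<le> C' * (m + \<kappa>)" if kp: "0 < \<kappa>" for \<kappa>
    proof -
      \<comment> \<open>The number 32 forces the squared distance of the touching point from
        \<open>xb\<close> to be at most \<open>\<rho>\<^sup>2 / 32\<close>, which is below the
        square of \<open>3 / 16 * \<rho>\<close>.\<close>
      define A where "A = 32 * (m + \<kappa>) / \<rho>\<^sup>2"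
      have A: "0 < A" using m0 kp rho by (simp add: A_def)
      define v where "v = (\<lambda>y. u y + A * (norm (y - xb))\<^sup>2)"
      have "continuous_on (cball xb (\<rho> / 4)) v" unfolding v_def
        by (intro continuous_intros continuous_on_subset[OF uc sub])
      then obtain x0 where x0: "x0 \<in> cball xb (\<rho> / 4)" and mv: "\<And>y. y \<in> cball xb (\<rho> / 4) \<Longrightarrow> v x0 \<le> v y"
        using continuous_attains_inf[of "cball xb (\<rho> / 4)" v] rho by auto
      have x0b: "x0 \<in> ball e \<rho>" using x0 sub by blast
      have "v x0 \<le> v xb" using rho by (intro mv) auto
      hence v0: "u x0 + A * (norm (x0 - xb))\<^sup>2 \<le> m" by (simp add: v_def m_def)
      have nn: "0 \<le> A * (norm (x0 - xb))\<^sup>2" using A by simp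
      have um: "u x0 \<le> m" using v0 nn by linarith
      have "A * (norm (x0 - xb))\<^sup>2 \<le> m + \<kappa>" using v0 ub[OF x0b] kp by linarith
      also have "\<dots> = A * (\<rho>\<^sup>2 / 32)" using rho by (simp add: A_def)
      finally have "(norm (x0 - xb))\<^sup>2 \<le> \<rho>\<^sup>2 / 32" using A by simp
      also have "\<dots> \<le> (3 / 16 * \<rho>)\<^sup>2"
      proof -
        have "(3 / 16 * \<rho>)\<^sup>2 = 9 / 256 * \<rho>\<^sup>2" unfolding power2_eq_square by simp
        thus ?thesis using zero_le_power2[of \<rho>] by linarith
      qed
      finally have close: "norm (x0 - xb) \<le> 3 / 16 * \<rho>" by (rule power2_le_imp_le) (use rho in simp)
      define b where "b = (2 * A) *\<^sub>R (x0 - xb)"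
      have "norm b = 2 * A * norm (x0 - xb)" using A by (simp add: b_def)
      also have "\<dots> \<le> 2 * A * (3 / 16 * \<rho>)" using A close by (intro mult_left_mono) auto
      also have "\<dots> = A * (3 / 8 * \<rho>)" by simp
      also have "\<dots> \<le> A * 1" using A rho by (intro mult_left_mono) auto
      finally have nb: "norm b \<le> A" by simp
      have in4: "y \<in> cball xb (\<rho> / 4)" if "y \<in> cball x0 \<delta>" for y
        using that close dl dist_triangle[of xb y x0] by (simp add: dist_norm norm_minus_commute)
      have touch: "u x0 - u y \<le> b \<bullet> (y - x0) + A * (norm (y - x0))\<^sup>2" if "y \<in> cball x0 \<delta>" for y
      proof -
        have "u x0 - u y \<le> A * ((norm (y - xb))\<^sup>2 - (norm (x0 - xb))\<^sup>2)"
          using mv[OF in4[OF that]] by (simp add: v_def right_diff_distrib)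
        also have "\<dots> = b \<bullet> (y - x0) + A * (norm (y - x0))\<^sup>2"
          unfolding norm_sq_expand[of y xb x0] by (simp add: b_def algebra_simps)
        finally show ?thesis .
      qed
      obtain L where lim: "((\<lambda>\<epsilon>. integral (halfspace e - ball x0 \<epsilon>) (frac_kernel_integrand s e u x0)) \<longlongrightarrow> L) (at_right 0)"
        and L: "- K * u x0 \<le> L" and fi: "\<And>\<epsilon>. 0 < \<epsilon> \<Longrightarrow> frac_kernel_integrand s e u x0 integrable_on (halfspace e - ball x0 \<epsilon>)"
        using ctr x0b unfolding controlled_def by blast
      have subd: "cball x0 \<delta> \<subseteq> ball e \<rho>" using in4 sub by blast
      have "compact (u ` cball x0 \<delta>)"
        by (intro compact_continuous_image continuous_on_subset[OF uc subd]) auto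
      hence "\<exists>B. \<forall>y\<in>cball x0 \<delta>. \<bar>u y\<bar> \<le> B"
        using compact_imp_bounded[of "u ` cball x0 \<delta>"] unfolding bounded_iff by simp
      then obtain B where B: "\<And>y. y \<in> cball x0 \<delta> \<Longrightarrow> \<bar>u y\<bar> \<le> B" by blast
      have "\<forall>\<^sub>F \<epsilon> in at_right (0::real). 0 < \<epsilon> \<and> \<epsilon> < \<delta>"
        using dl by (intro eventually_at_rightI[of 0 \<delta>]) auto
      \<comment> \<open>\<open>lower_touch\<close> sees the weight only outside the removed ball.
        The missing mass is at most \<open>vol1 * \<epsilon> ^ DIM('a) * B\<close>; here
        \<open>B\<close> depends on \<open>u\<close>, but the term disappears in the limit.\<close>
      hence ev: "\<forall>\<^sub>F \<epsilon> in at_right 0. integral (halfspace e - ball x0 \<epsilon>) (frac_kernel_integrand s e u x0)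
          \<le> C * (u x0 + A + norm b) - k * (J - vol1 * \<epsilon> ^ DIM('a) * B)"
      proof eventually_elim
        case (elim \<epsilon>)
        have bH: "ball x0 \<epsilon> \<subseteq> halfspace e" using cball_subset(2)[OF x0b dl(2)] elim by auto
        have ab: "As_weight s e u absolutely_integrable_on halfspace e"
          using ui wt_nonneg by (intro nonnegative_absolutely_integrable_1) (auto simp: As_weight_eq)
        have i1: "As_weight s e u integrable_on (halfspace e - ball x0 \<epsilon>)"
          by (intro set_lebesgue_integral_eq_integral(1) set_integrable_subset[OF ab]) (auto intro!: sets_completionI_sets)
        have i2: "As_weight s e u integrable_on ball x0 \<epsilon>"
          by (intro set_lebesgue_integral_eq_integral(1) set_integrable_subset[OF ab _ bH]) (auto intro!: sets_completionI_sets)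
        have "J = integral ((halfspace e - ball x0 \<epsilon>) \<union> ball x0 \<epsilon>) (As_weight s e u)"
          using bH unfolding J_def As_norm_def by (intro arg_cong2[where f=integral]) auto
        also have "\<dots> = integral (halfspace e - ball x0 \<epsilon>) (As_weight s e u) + integral (ball x0 \<epsilon>) (As_weight s e u)"
          by (intro integral_Un i1 i2) (auto intro: negligible_subset[of "{}"])
        also have "integral (ball x0 \<epsilon>) (As_weight s e u) \<le> integral (ball x0 \<epsilon>) (\<lambda>_. B)"
        proof (intro integral_le i2 integrable_on_const lmeasurable_ball)
          fix y assume y: "y \<in> ball x0 \<epsilon>"
          have "wt y * \<bar>u y\<bar> \<le> 1 * B" using y bH elim B[of y] wt_le(1)[of y] wt_nonneg[of y]
            by (intro mult_mono) auto
          thus "As_weight s e u y \<le> B" by (simp add: As_weight_eq)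
        qed
        also have "integral (ball x0 \<epsilon>) (\<lambda>_. B) = vol1 * \<epsilon> ^ DIM('a) * B"
          using elim integral_mult_right[of "ball x0 \<epsilon>" B "\<lambda>_. 1::real"]
          by (simp add: lmeasure_integral[OF lmeasurable_ball, symmetric] content_ball vol1_def mult.commute)
        finally have "J - vol1 * \<epsilon> ^ DIM('a) * B \<le> integral (halfspace e - ball x0 \<epsilon>) (As_weight s e u)" by simp
        hence "k * (J - vol1 * \<epsilon> ^ DIM('a) * B) \<le> k * integral (halfspace e - ball x0 \<epsilon>) (As_weight s e u)"
          using k by (intro mult_left_mono) auto
        moreover have "integral (halfspace e - ball x0 \<epsilon>) (frac_kernel_integrand s e u x0)
          \<le> C * (u x0 + A + norm b) - k * integral (halfspace e - ball x0 \<epsilon>) (As_weight s e u)"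
          using elim u0 ui touch A fi by (intro lt[OF x0b]) auto
        ultimately show ?case by linarith
      qed
      have "((\<lambda>\<epsilon>. C * (u x0 + A + norm b) - k * (J - vol1 * \<epsilon> ^ DIM('a) * B))
          \<longlongrightarrow> C * (u x0 + A + norm b) - k * (J - vol1 * 0 ^ DIM('a) * B)) (at_right 0)"
        by (intro tendsto_intros)
      hence "L \<le> C * (u x0 + A + norm b) - k * (J - vol1 * 0 ^ DIM('a) * B)"
        using ev lim by (intro tendsto_le[of "at_right 0"]) auto
      moreover have "(0::real) ^ DIM('a) = 0" by (rule zero_power) simp
      ultimately have "k * J \<le> C * (u x0 + A + norm b) - L" by (simp add: algebra_simps)
      also have "\<dots> \<le> C * (m + 2 * A) + K * m"
      proof -
        have "C * (u x0 + A + norm b) \<le> C * (m + 2 * A)" using C um nb by (intro mult_left_mono) auto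
        moreover have "K * u x0 \<le> K * m" using K um by (intro mult_left_mono) auto
        ultimately show ?thesis using L by linarith
      qed
      also have "\<dots> \<le> C * ((m + \<kappa>) + 2 * A) + K * (m + \<kappa>)"
        using C K kp by (intro add_mono mult_left_mono) auto
      also have "\<dots> = k * (C' * (m + \<kappa>))"
        using k rho by (simp add: C'_def A_def field_simps)
      finally show ?thesis using k by simp
    qed
    have "J \<le> C' * m"
    proof (rule field_le_epsilon)
      fix t :: real assume "0 < t"
      thus "J \<le> C' * m + t" using main[of "t / C'"] C' by (simp add: distrib_left)
    qed
    thus ?thesis by (simp add: J_def m_def)
  qed
  thus ?thesis using C' by (intro exI[of _ C'] conjI) auto
qed

end

text \<open>The remaining two comparisons of the extrema with the norm follow from the displayed
  ones, because the infimum is at most the supremum.\<close>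

theorem mainTheorem2:
  fixes e :: "'a::euclidean_space" and s \<rho> M :: real
  assumes "e \<in> Basis" and "0 < s" and "s < 1"
    and "0 < \<rho>" and "\<rho> < 1" and "0 \<le> M"
  shows "\<exists>C>0. \<forall>(c :: 'a \<Rightarrow> real) (u :: 'a \<Rightarrow> real) \<alpha>.
    set_borel_measurable lebesgue (ball e \<rho>) c \<and>
    (AE x in lebesgue. x \<in> ball e \<rho> \<longrightarrow> \<bar>c x\<bar> \<le> M) \<and>
    0 < \<alpha> \<and> 2 * s + \<alpha> \<notin> \<int> \<and>
    hoelder (2 * s + \<alpha>) (ball e \<rho>) u \<and> As_space s e u \<and>
    (\<forall>x\<in>halfspace e. 0 \<le> u x) \<and>
    (\<forall>x\<in>ball e \<rho>. frac_laplacian_at s e u x (- (c x * u x)))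
    \<longrightarrow>
    Sup (u ` ball e (\<rho>/2)) \<le> C * Inf (u ` ball e (\<rho>/2)) \<and>
    As_norm s e u / C \<le> Inf (u ` ball e (\<rho>/2)) \<and>
    Sup (u ` ball e (\<rho>/2)) \<le> C * As_norm s e u"
proof -
  interpret antisym_setting e s \<rho> using assms by unfold_locales
  obtain K where K: "0 < K" and ctr: "\<And>c u \<alpha>. (AE x in lebesgue. x \<in> ball e \<rho> \<longrightarrow> \<bar>c x\<bar> \<le> M) \<Longrightarrow> 0 < \<alpha> \<Longrightarrow>
    hoelder (2 * s + \<alpha>) (ball e \<rho>) u \<Longrightarrow> As_space s e u \<Longrightarrow> (\<forall>x\<in>halfspace e. 0 \<le> u x) \<Longrightarrow>
    (\<forall>x\<in>ball e \<rho>. frac_laplacian_at s e u x (- (c x * u x))) \<Longrightarrow> controlled K u"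
    using solution_controlled[OF assms(6)] by blast
  obtain C1 where C1: "0 < C1" and up: "\<And>u x. controlled K u \<Longrightarrow> x \<in> ball e (\<rho>/2) \<Longrightarrow> u x \<le> C1 * As_norm s e u"
    using sup_le_As_norm[OF K] by blast
  obtain C2 where C2: "0 < C2" and lo: "\<And>u x. controlled K u \<Longrightarrow> x \<in> ball e (\<rho>/2) \<Longrightarrow> As_norm s e u \<le> C2 * u x"
    using As_norm_le_inf[OF K] by blast
  \<comment> \<open>Passing from the supremum to the infimum through \<open>As_norm\<close> costs
    \<open>C1 * C2\<close>; the sum also dominates the constants of the two norm bounds.\<close>
  define C where "C = C1 + C2 + C1 * C2"
  have C: "0 < C" "C1 \<le> C" "C2 \<le> C" "C1 * C2 \<le> C" using C1 C2 by (auto simp: C_def add_pos_pos)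
  have "Sup (u ` ball e (\<rho>/2)) \<le> C * Inf (u ` ball e (\<rho>/2)) \<and>
    As_norm s e u / C \<le> Inf (u ` ball e (\<rho>/2)) \<and>
    Sup (u ` ball e (\<rho>/2)) \<le> C * As_norm s e u" if "controlled K u" for u
  proof -
    define J where "J = As_norm s e u"
    define S where "S = u ` ball e (\<rho>/2)"
    have ne: "S \<noteq> {}" using rho by (simp add: S_def)
    have J: "0 \<le> J" unfolding J_def by (rule As_norm_nonneg[OF that])
    have S: "Sup S \<le> C1 * J" by (rule cSup_least[OF ne]) (auto simp: S_def J_def intro: up[OF that])
    have I: "J / C2 \<le> Inf S"
      by (rule cInf_greatest[OF ne]) (use lo[OF that] C2 in \<open>auto simp: S_def J_def field_simps\<close>)
    have I0: "0 \<le> Inf S" using I J C2 by (auto intro: order_trans[rotated])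
    have JI: "J \<le> C2 * Inf S" using I C2 by (simp add: field_simps)
    have "C1 * J \<le> C1 * (C2 * Inf S)" using JI C1 by (intro mult_left_mono) auto
    also have "\<dots> \<le> C * Inf S" using C(4) I0 mult_right_mono[of "C1 * C2" C "Inf S"] by (simp add: mult.assoc)
    finally have "Sup S \<le> C * Inf S" using S by linarith
    moreover have "J / C \<le> Inf S"
    proof -
      have "J / C \<le> J / C2" using J C C2 by (intro divide_left_mono) auto
      thus ?thesis using I by linarith
    qed
    moreover have "Sup S \<le> C * J" using S C(2) J mult_right_mono[of C1 C J] by linarith
    ultimately show ?thesis by (simp add: S_def J_def)
  qed
  thus ?thesis using ctr C(1) by (intro exI[of _ C] conjI allI impI) blast+
qed

end
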